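(* Let $\mathcal G$ be a connected reductive linear algebraic group over $\mathbb Q$, and let $f\in C_c^\infty(\mathcal G(\mathbb A)^1)$ be parabolically regular at the infinite place. Then, for each equivalence class $\mathfrak o$ in $\mathcal G(\mathbb Q)$, Arthur's distribution $J_{\mathfrak o}(f)$ vanishes unless $\mathfrak o$ is $\mathbb Q$-elliptic, in which case $$J_{\mathfrak o}(f)=\int_{\mathcal G(\mathbb Q)\backslash\mathcal G(\mathbb A)^1}K_{\mathcal G,\mathfrak o}(x,x)\,dx .$$
   Context: $\mathbb A$ is the adele ring of $\mathbb Q$, $\mathbb A_{\rm fin}$ the ring of finite adeles. For a linear algebraic $\mathbb Q$-group $\mathcal H$ and $E=\mathbb R$ or $\mathbb A$, $\mathcal H(E)^1$ is the subgroup of all $h\in\mathcal H(E)$ with $|\chi(h)|=1$ for all rational characters $\chi$ of $\mathcal H$ defined over $\mathbb Q$. Write $G=\mathcal G(\mathbb R)$, $G^1=\mathcal G(\mathbb R)^1$, and for a parabolic $\mathbb Q$-subgroup $\mathcal P$, $P^1=\mathcal P(\mathbb R)^1$. A function on $\mathcal G(\mathbb A)^1$ is called parabolically regular at the infinite place if it is supported on $K_{\rm fin}\times G^1$ for some compact open subgroup $K_{\rm fin}$ of $\mathcal G(\mathbb A_{\rm fin})$ and vanishes on all $G$-conjugates of $K_{\rm fin}\times P^1$ for every parabolic $\mathbb Q$-subgroup $\mathcal P\ne\mathcal G$. Two elements of $\mathcal G(\mathbb Q)$ are equivalent if the semisimple components in their Jordan decompositions are conjugate in $\mathcal G(\mathbb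 Q)$; $\mathfrak o$ denotes an equivalence class. An element of $\mathcal G(\mathbb Q)$ is $\mathbb Q$-elliptic if it is not contained in any parabolic $\mathbb Q$-subgroup other than $\mathcal G$; a class $\mathfrak o$ is $\mathbb Q$-elliptic if some (hence any) of its elements is. Arthur's distributions: fix a minimal parabolic $\mathbb Q$-subgroup $\mathcal P_0$ with a Levi component, and a suitable maximal compact subgroup $\mathbf K$ of $\mathcal G(\mathbb A)$ with $\mathcal G(\mathbb A)=\mathcal P_0(\mathbb A)\mathbf K$. Standard parabolics are the parabolic $\mathbb Q$-subgroups $\mathcal P=\mathcal L\mathcal N\supset\mathcal P_0$ ($\mathcal L$ the Levi component containing the fixed one, $\mathcal N$ the unipotent radical, $\mathcal A_{\mathcal P}$ the maximal $\mathbb Q$-split torus in the center of $\mathcal L$). For such $\mathcal P$, $$K_{\mathcal P,\mathfrak o}(x,y)=\sum_{\gamma\in\mathcal L(\mathbb Q)\cap\mathfrak o}\int_{\mathcal N(\mathbb A)}f(x^{-1}\gamma n y)\,dn ,$$ so that $K_{\mathcal G,\mathfrak o}(x,x)=\sum_{\gamma\in\mathfrak o}f(x^{-1}\gamma x)$. Put $$k_{\mathfrak o}(x)=\sum_{\mathcal P}(-1)^{\dim \mathcal A_{\mathcal P}/\mathcal A_{\mathcal G}}\sum_{\delta\in\mathcal P(\mathbb Q)\backslash\mathcal G(\mathbb Q)}K_{\mathcal P,\mathfrak o}(\delta x,\delta x)\,\hat\tau_{\mathcal P}(H(\delta x)-T),\qquad J_{\mathfrak o}(f)=\int_{\mathcal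 G(\mathbb Q)\backslash\mathcal G(\mathbb A)^1}k_{\mathfrak o}(x)\,dx,$$ the sum running over standard $\mathcal P$. Here $H$ is the usual height map $\mathcal G(\mathbb A)\to\mathfrak a_{\mathcal P_0}$ defined by the Iwasawa decomposition, $T$ is a fixed sufficiently regular truncation parameter in the positive chamber of $\mathfrak a_{\mathcal P_0}$, and $\hat\tau_{\mathcal P}$ is the characteristic function of the set where all fundamental weights attached to $\mathcal P$ are positive; for $\mathcal P=\mathcal G$ this factor is identically $1$. By Arthur, these integrals converge absolutely. *)

theory Defs
  imports "HOL-Analysis.Analysis" "HOL-Library.Poly_Mapping" "HOL-Algebra.Solvable_Groups"
begin

section \<open>Finite adeles of the rationals\<close>

definition padic_abs :: "nat \<Rightarrow> rat \<Rightarrow> real" where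
  "padic_abs p q = (if q = 0 then 0
     else real p powi (int (multiplicity (int p) (snd (quotient_of q)))
                     - int (multiplicity (int p) (fst (quotient_of q)))))"

lemma padic_abs_fraction:
  assumes p: "prime p" and "a \<noteq> 0" "b \<noteq> 0"
  shows "padic_abs p (of_int a / of_int b)
       = real p powi (int (multiplicity (int p) b) - int (multiplicity (int p) a))"
proof -
  obtain c d where cd: "quotient_of (of_int a / of_int b) = (c, d)" by fastforce
  have d: "d > 0" using quotient_of_denom_pos[OF cd] .
  have eq: "(of_int a / of_int b :: rat) = of_int c / of_int d"
    using quotient_of_div[OF cd] .
  have ne: "(of_int a / of_int b :: rat) \<noteq> 0" using assms by simp
  then have c: "c \<noteq> 0" using eq by auto
  have "(of_int (a * d) :: rat) = of_int (c * b)"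
    using eq d assms by (simp add: field_simps)
  then have ad: "a * d = c * b" by (simp only: of_int_eq_iff)
  have P: "prime_elem (int p)" using p by simp
  have "multiplicity (int p) a + multiplicity (int p) d
      = multiplicity (int p) c + multiplicity (int p) b"
    using prime_elem_multiplicity_mult_distrib[OF P, of a d]
      prime_elem_multiplicity_mult_distrib[OF P, of c b] ad assms c d by simp
  then have "int (multiplicity (int p) d) - int (multiplicity (int p) c)
      = int (multiplicity (int p) b) - int (multiplicity (int p) a)" by linarith
  then show ?thesis using ne cd by (simp add: padic_abs_def)
qed

lemma rat_common_denom:
  fixes x y :: rat
  obtains a c d where "d \<noteq> 0" "x = of_int a / of_int d" "y = of_int c / of_int d"
proof -
  obtain a b where ab: "quotient_of x = (a, b)" by fastforce
  obtain c d where cd: "quotient_of y = (c, d)" by fastforce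
  note * = quotient_of_denom_pos[OF ab] quotient_of_denom_pos[OF cd]
    quotient_of_div[OF ab] quotient_of_div[OF cd]
  show thesis
    by (rule that[of "b * d" "a * d" "c * b"]) (use * in auto)
qed

lemma padic_abs_0 [simp]: "padic_abs p 0 = 0"
  by (simp add: padic_abs_def)

lemma padic_abs_nonneg [simp]: "padic_abs p q \<ge> 0"
  by (simp add: padic_abs_def)

lemma padic_abs_1 [simp]: "padic_abs p 1 = 1"
  by (simp add: padic_abs_def)

lemma padic_abs_mult:
  assumes p: "prime p" shows "padic_abs p (x * y) = padic_abs p x * padic_abs p y"
proof (cases "x = 0 \<or> y = 0")
  case False
  obtain a c d where d: "d \<noteq> 0" "x = of_int a / of_int d" "y = of_int c / of_int d"
    by (rule rat_common_denom)
  have ac: "a \<noteq> 0" "c \<noteq> 0" using False d by auto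
  have xy: "x * y = of_int (a * c) / of_int (d * d)" using d by simp
  have P: "prime_elem (int p)" using p by simp
  have p0: "real p \<noteq> 0" using p by (auto dest: prime_gt_0_nat)
  let ?m = "\<lambda>z. int (multiplicity (int p) z)"
  have "padic_abs p (x * y) = real p powi ((?m d - ?m a) + (?m d - ?m c))"
    unfolding xy using d(1) ac
    by (subst padic_abs_fraction[OF p])
       (simp_all add: prime_elem_multiplicity_mult_distrib[OF P] algebra_simps)
  also have "\<dots> = real p powi (?m d - ?m a) * real p powi (?m d - ?m c)"
    by (rule power_int_add) (use p0 in simp)
  also have "\<dots> = padic_abs p x * padic_abs p y"
    unfolding d using d(1) ac by (simp only: padic_abs_fraction[OF p] not_False_eq_True)
  finally show ?thesis .
qed auto

lemma padic_abs_minus [simp]: "padic_abs p (- x) = padic_abs p x"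
  by (cases "quotient_of x") (auto simp: padic_abs_def rat_uminus_code multiplicity_def)

lemma padic_abs_ultra:
  assumes p: "prime p" shows "padic_abs p (x + y) \<le> max (padic_abs p x) (padic_abs p y)"
proof (cases "x = 0 \<or> y = 0 \<or> x + y = 0")
  case False
  obtain a c d where d: "d \<noteq> 0" "x = of_int a / of_int d" "y = of_int c / of_int d"
    by (rule rat_common_denom)
  have xy: "x + y = of_int (a + c) / of_int d" using d by (simp add: add_divide_distrib)
  have ne: "a \<noteq> 0" "c \<noteq> 0" "a + c \<noteq> 0" using False d xy by auto
  have nu: "\<not> is_unit (int p)" using p by (metis not_prime_unit prime_nat_int_transfer)
  let ?m = "\<lambda>z. multiplicity (int p) z"
  have "int p ^ min (?m a) (?m c) dvd a + c"
    by (intro dvd_add multiplicity_dvd') auto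
  then have le: "min (?m a) (?m c) \<le> ?m (a + c)"
    using multiplicity_geI[OF ne(3) nu] by blast
  have p1: "1 \<le> real p" using prime_ge_1_nat[OF p] by simp
  have "real p powi (int (?m d) - int (?m (a + c)))
      \<le> real p powi (int (?m d) - int (min (?m a) (?m c)))"
    by (rule power_int_increasing) (use le p1 in auto)
  also have "\<dots> \<le> max (real p powi (int (?m d) - int (?m a))) (real p powi (int (?m d) - int (?m c)))"
    by (auto simp: min_def)
  finally show ?thesis
    unfolding xy unfolding d using d(1) ne by (simp only: padic_abs_fraction[OF p] not_False_eq_True)
qed (auto simp: max_def)

lemma padic_abs_triangle: "prime p \<Longrightarrow> padic_abs p (x + y) \<le> padic_abs p x + padic_abs p y"
  using padic_abs_ultra[of p x y] padic_abs_nonneg[of p x] padic_abs_nonneg[of p y] by linarith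

lemma padic_abs_finite: "finite {p. prime p \<and> \<not> padic_abs p q \<le> 1}"
proof (cases "q = 0")
  case False
  obtain a b where ab: "quotient_of q = (a, b)" by fastforce
  have b: "b > 0" using quotient_of_denom_pos[OF ab] .
  have "{p. prime p \<and> \<not> padic_abs p q \<le> 1} \<subseteq> {p. p dvd nat b}"
  proof safe
    fix p :: nat assume p: "prime p" and h: "\<not> padic_abs p q \<le> 1"
    show "p dvd nat b"
    proof (rule ccontr)
      assume "\<not> p dvd nat b"
      then have "\<not> int p dvd b" using b by (simp add: int_dvd_int_iff[symmetric])
      then have "multiplicity (int p) b = 0" by (rule not_dvd_imp_multiplicity_0)
      moreover have "1 \<le> real p" using prime_ge_1_nat[OF p] by simp
      ultimately have "padic_abs p q \<le> real p powi 0"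
        using False ab by (simp add: padic_abs_def power_int_minus field_simps)
      then show False using h by simp
    qed
  qed
  then show ?thesis by (rule finite_subset) (use b in simp)
qed simp

definition padic_cauchy :: "nat \<Rightarrow> (nat \<Rightarrow> rat) \<Rightarrow> bool" where
  "padic_cauchy p X \<longleftrightarrow> (\<forall>e>0. \<exists>N. \<forall>m\<ge>N. \<forall>n\<ge>N. padic_abs p (X m - X n) < e)"

text \<open>A finite adele is a family, indexed by the primes, of elements of the completions of the
  rationals for the p-adic absolute values, almost all of them p-adic integers. It is represented
  by a family of Cauchy sequences; the index p is only inspected at primes.\<close>

definition fadele_rep :: "(nat \<Rightarrow> nat \<Rightarrow> rat) \<Rightarrow> bool" where
  "fadele_rep X \<longleftrightarrow> (\<forall>p. prime p \<longrightarrow> padic_cauchy p (X p)) \<and>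
     finite {p. prime p \<and> \<not> (\<forall>\<^sub>F n in sequentially. padic_abs p (X p n) \<le> 1)}"

definition fadele_rel :: "(nat \<Rightarrow> nat \<Rightarrow> rat) \<Rightarrow> (nat \<Rightarrow> nat \<Rightarrow> rat) \<Rightarrow> bool" where
  "fadele_rel X Y \<longleftrightarrow> fadele_rep X \<and> fadele_rep Y \<and>
     (\<forall>p. prime p \<longrightarrow> (\<lambda>n. padic_abs p (X p n - Y p n)) \<longlonglongrightarrow> 0)"

lemma padic_cauchy_bounded:
  assumes p: "prime p" and "padic_cauchy p X"
  obtains B where "B > 0" "\<And>n. padic_abs p (X n) \<le> B"
proof -
  obtain N where N: "\<And>m n. m \<ge> N \<Longrightarrow> n \<ge> N \<Longrightarrow> padic_abs p (X m - X n) < 1"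
    using assms(2) zero_less_one unfolding padic_cauchy_def by blast
  define B where "B = 1 + (\<Sum>n\<le>N. padic_abs p (X n))"
  have S: "0 \<le> (\<Sum>n\<le>N. padic_abs p (X n))" by (simp add: sum_nonneg)
  have "padic_abs p (X n) \<le> B" for n
  proof (cases "n \<le> N")
    case True
    then have "padic_abs p (X n) \<le> (\<Sum>n\<le>N. padic_abs p (X n))"
      by (intro member_le_sum) auto
    then show ?thesis by (simp add: B_def)
  next
    case False
    have "padic_abs p (X n) \<le> padic_abs p (X n - X N) + padic_abs p (X N)"
      using padic_abs_triangle[OF p, of "X n - X N" "X N"] by simp
    moreover have "padic_abs p (X N) \<le> (\<Sum>n\<le>N. padic_abs p (X n))"
      by (intro member_le_sum) auto
    ultimately show ?thesis using N[of n N] False by (simp add: B_def)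
  qed
  then show thesis using that[of B] S by (simp add: B_def)
qed

lemma padic_cauchy_const: "padic_cauchy p (\<lambda>_. q)"
  by (simp add: padic_cauchy_def)

lemma padic_cauchy_add:
  assumes p: "prime p" and "padic_cauchy p X" "padic_cauchy p Y"
  shows "padic_cauchy p (\<lambda>n. X n + Y n)"
  unfolding padic_cauchy_def
proof safe
  fix e :: real assume e: "e > 0"
  obtain M N where M: "\<forall>m\<ge>M. \<forall>n\<ge>M. padic_abs p (X m - X n) < e"
    and N: "\<forall>m\<ge>N. \<forall>n\<ge>N. padic_abs p (Y m - Y n) < e"
    using assms(2,3) e unfolding padic_cauchy_def by meson
  show "\<exists>N. \<forall>m\<ge>N. \<forall>n\<ge>N. padic_abs p (X m + Y m - (X n + Y n)) < e"
  proof (intro exI allI impI)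
    fix m n assume mn: "max M N \<le> m" "max M N \<le> n"
    have "X m + Y m - (X n + Y n) = (X m - X n) + (Y m - Y n)" by simp
    then show "padic_abs p (X m + Y m - (X n + Y n)) < e"
      using padic_abs_ultra[OF p, of "X m - X n" "Y m - Y n"] M N mn
      by (smt (verit) max.bounded_iff)
  qed
qed

lemma padic_cauchy_minus: "padic_cauchy p X \<Longrightarrow> padic_cauchy p (\<lambda>n. - X n)"
proof -
  have "padic_abs p (- X m - - X n) = padic_abs p (X m - X n)" for m n
    by (metis minus_diff_minus padic_abs_minus)
  then show "padic_cauchy p X \<Longrightarrow> padic_cauchy p (\<lambda>n. - X n)"
    by (simp only: padic_cauchy_def)
qed

lemma padic_cauchy_mult:
  assumes p: "prime p" and X: "padic_cauchy p X" and Y: "padic_cauchy p Y"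
  shows "padic_cauchy p (\<lambda>n. X n * Y n)"
  unfolding padic_cauchy_def
proof safe
  fix e :: real assume e: "e > 0"
  obtain B where B: "B > 0" "\<And>n. padic_abs p (X n) \<le> B" using padic_cauchy_bounded[OF p X] by blast
  obtain C where C: "C > 0" "\<And>n. padic_abs p (Y n) \<le> C" using padic_cauchy_bounded[OF p Y] by blast
  obtain M where M: "\<forall>m\<ge>M. \<forall>n\<ge>M. padic_abs p (X m - X n) < e / C"
    using X e C(1) unfolding padic_cauchy_def by (meson divide_pos_pos)
  obtain N where N: "\<forall>m\<ge>N. \<forall>n\<ge>N. padic_abs p (Y m - Y n) < e / B"
    using Y e B(1) unfolding padic_cauchy_def by (meson divide_pos_pos)
  show "\<exists>N. \<forall>m\<ge>N. \<forall>n\<ge>N. padic_abs p (X m * Y m - X n * Y n) < e"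
  proof (intro exI allI impI)
    fix m n assume mn: "max M N \<le> m" "max M N \<le> n"
    have eq: "X m * Y m - X n * Y n = X m * (Y m - Y n) + (X m - X n) * Y n"
      by (simp add: algebra_simps)
    have "padic_abs p (X m * (Y m - Y n)) < e"
    proof -
      have "padic_abs p (X m) * padic_abs p (Y m - Y n) \<le> B * padic_abs p (Y m - Y n)"
        using B by (intro mult_right_mono) auto
      also have "\<dots> < B * (e / B)" using N mn B(1) by (intro mult_strict_left_mono) auto
      finally show ?thesis using B(1) by (simp add: padic_abs_mult[OF p])
    qed
    moreover have "padic_abs p ((X m - X n) * Y n) < e"
    proof -
      have "padic_abs p (X m - X n) * padic_abs p (Y n) \<le> padic_abs p (X m - X n) * C"
        using C by (intro mult_left_mono) auto
      also have "\<dots> < e / C * C" using M mn C(1) by (intro mult_strict_right_mono) auto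
      finally show ?thesis using C(1) by (simp add: padic_abs_mult[OF p])
    qed
    ultimately show "padic_abs p (X m * Y m - X n * Y n) < e"
      using padic_abs_ultra[OF p, of "X m * (Y m - Y n)" "(X m - X n) * Y n"] eq by simp
  qed
qed

lemma fadele_rep_const: "fadele_rep (\<lambda>_ _. q)"
  by (simp add: fadele_rep_def padic_cauchy_const padic_abs_finite)

lemma fadele_rep_add:
  assumes "fadele_rep X" "fadele_rep Y" shows "fadele_rep (\<lambda>p n. X p n + Y p n)"
proof -
  let ?bad = "\<lambda>X. {p. prime p \<and> \<not> (\<forall>\<^sub>F n in sequentially. padic_abs p (X p n) \<le> 1)}"
  have "?bad (\<lambda>p n. X p n + Y p n) \<subseteq> ?bad X \<union> ?bad Y"
  proof (rule subsetI, rule ccontr, clarsimp)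
    fix p :: nat assume p: "prime p"
      and n: "\<not> (\<forall>\<^sub>F n in sequentially. padic_abs p (X p n + Y p n) \<le> 1)"
    assume "\<forall>\<^sub>F n in sequentially. padic_abs p (Y p n) \<le> 1"
      and "\<forall>\<^sub>F n in sequentially. padic_abs p (X p n) \<le> 1"
    then have "\<forall>\<^sub>F n in sequentially. padic_abs p (X p n + Y p n) \<le> 1"
      by eventually_elim (use padic_abs_ultra[OF p] in \<open>meson max.boundedI order_trans\<close>)
    with n show False by simp
  qed
  then show ?thesis using assms
    by (auto simp: fadele_rep_def padic_cauchy_add intro: finite_subset)
qed

lemma fadele_rep_mult:
  assumes "fadele_rep X" "fadele_rep Y" shows "fadele_rep (\<lambda>p n. X p n * Y p n)"
proof -
  let ?bad = "\<lambda>X. {p. prime p \<and> \<not> (\<forall>\<^sub>F n in sequentially. padic_abs p (X p n) \<le> 1)}"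
  have "?bad (\<lambda>p n. X p n * Y p n) \<subseteq> ?bad X \<union> ?bad Y"
  proof (rule subsetI, rule ccontr, clarsimp)
    fix p :: nat assume p: "prime p"
      and n: "\<not> (\<forall>\<^sub>F n in sequentially. padic_abs p (X p n * Y p n) \<le> 1)"
    assume "\<forall>\<^sub>F n in sequentially. padic_abs p (Y p n) \<le> 1"
      and "\<forall>\<^sub>F n in sequentially. padic_abs p (X p n) \<le> 1"
    then have "\<forall>\<^sub>F n in sequentially. padic_abs p (X p n * Y p n) \<le> 1"
      by eventually_elim (simp add: padic_abs_mult[OF p] mult_le_one)
    with n show False by simp
  qed
  then show ?thesis using assms
    by (auto simp: fadele_rep_def padic_cauchy_mult intro: finite_subset)
qed

lemma fadele_rep_minus: "fadele_rep X \<Longrightarrow> fadele_rep (\<lambda>p n. - X p n)"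
  by (simp add: fadele_rep_def padic_cauchy_minus)

lemma padic_null_add:
  assumes p: "prime p" and "(\<lambda>n. padic_abs p (X n)) \<longlonglongrightarrow> 0" "(\<lambda>n. padic_abs p (Y n)) \<longlonglongrightarrow> 0"
  shows "(\<lambda>n. padic_abs p (X n + Y n)) \<longlonglongrightarrow> 0"
proof (rule tendsto_sandwich[OF _ _ tendsto_const])
  show "(\<lambda>n. padic_abs p (X n) + padic_abs p (Y n)) \<longlonglongrightarrow> 0"
    using tendsto_add[OF assms(2,3)] by simp
qed (auto intro!: always_eventually padic_abs_triangle[OF p])

lemma padic_null_mult:
  assumes p: "prime p" and "padic_cauchy p X" and Y: "(\<lambda>n. padic_abs p (Y n)) \<longlonglongrightarrow> 0"
  shows "(\<lambda>n. padic_abs p (X n * Y n)) \<longlonglongrightarrow> 0"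
proof -
  obtain B where B: "B > 0" "\<And>n. padic_abs p (X n) \<le> B"
    using padic_cauchy_bounded[OF p assms(2)] by blast
  show ?thesis
  proof (rule tendsto_sandwich[OF _ _ tendsto_const])
    show "(\<lambda>n. B * padic_abs p (Y n)) \<longlonglongrightarrow> 0"
      using tendsto_mult[OF tendsto_const Y, of B] by simp
  qed (auto intro!: always_eventually mult_right_mono B simp: padic_abs_mult[OF p])
qed

quotient_type fadele = "nat \<Rightarrow> nat \<Rightarrow> rat" / partial: fadele_rel
proof (rule part_equivpI)
  show "\<exists>X. fadele_rel X X"
    by (rule exI[of _ "\<lambda>_ _. 0"]) (simp add: fadele_rel_def fadele_rep_const)
  show "symp fadele_rel"
  proof (rule sympI)
    fix X Y assume "fadele_rel X Y"
    moreover have "padic_abs p (X p n - Y p n) = padic_abs p (Y p n - X p n)" for p n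
      by (metis minus_diff_eq padic_abs_minus)
    ultimately show "fadele_rel Y X" by (simp add: fadele_rel_def)
  qed
  show "transp fadele_rel"
  proof (rule transpI)
    fix X Y Z assume h: "fadele_rel X Y" "fadele_rel Y Z"
    have "(\<lambda>n. padic_abs p (X p n - Z p n)) \<longlonglongrightarrow> 0" if "prime p" for p
      using padic_null_add[OF that, of "\<lambda>n. X p n - Y p n" "\<lambda>n. Y p n - Z p n"] h that
      by (simp add: fadele_rel_def)
    then show "fadele_rel X Z" using h by (simp add: fadele_rel_def)
  qed
qed

lemma fadele_rel_refl: "fadele_rep X \<Longrightarrow> fadele_rel X X"
  by (simp add: fadele_rel_def)

lemma fadele_rel_repD: "fadele_rel X X \<Longrightarrow> fadele_rep X"
  by (simp add: fadele_rel_def)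

instantiation fadele :: comm_ring_1
begin

lift_definition zero_fadele :: fadele is "\<lambda>_ _. 0"
  by (simp add: fadele_rel_def fadele_rep_const)

lift_definition one_fadele :: fadele is "\<lambda>_ _. 1"
  by (simp add: fadele_rel_def fadele_rep_const)

lift_definition plus_fadele :: "fadele \<Rightarrow> fadele \<Rightarrow> fadele" is "\<lambda>X Y p n. X p n + Y p n"
proof -
  fix X X' Y Y' assume h: "fadele_rel X X'" "fadele_rel Y Y'"
  have "(\<lambda>n. padic_abs p (X p n + Y p n - (X' p n + Y' p n))) \<longlonglongrightarrow> 0" if "prime p" for p
    using padic_null_add[OF that, of "\<lambda>n. X p n - X' p n" "\<lambda>n. Y p n - Y' p n"] h that
    by (simp add: fadele_rel_def algebra_simps)
  then show "fadele_rel (\<lambda>p n. X p n + Y p n) (\<lambda>p n. X' p n + Y' p n)"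
    using h by (simp add: fadele_rel_def fadele_rep_add)
qed

lift_definition uminus_fadele :: "fadele \<Rightarrow> fadele" is "\<lambda>X p n. - X p n"
proof -
  fix X X' assume h: "fadele_rel X X'"
  have "padic_abs p (- X p n + X' p n) = padic_abs p (X p n - X' p n)" for p n
    by (metis minus_diff_eq padic_abs_minus uminus_add_conv_diff)
  then show "fadele_rel (\<lambda>p n. - X p n) (\<lambda>p n. - X' p n)"
    using h by (simp add: fadele_rel_def fadele_rep_minus)
qed

definition minus_fadele :: "fadele \<Rightarrow> fadele \<Rightarrow> fadele" where "x - y = x + - (y :: fadele)"

lift_definition times_fadele :: "fadele \<Rightarrow> fadele \<Rightarrow> fadele" is "\<lambda>X Y p n. X p n * Y p n"
proof -
  fix X X' Y Y' assume h: "fadele_rel X X'" "fadele_rel Y Y'"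
  have "(\<lambda>n. padic_abs p (X p n * Y p n - X' p n * Y' p n)) \<longlonglongrightarrow> 0" if p: "prime p" for p
  proof -
    have "(\<lambda>n. padic_abs p (X p n * (Y p n - Y' p n))) \<longlonglongrightarrow> 0"
      by (rule padic_null_mult[OF p]) (use h p in \<open>auto simp: fadele_rel_def fadele_rep_def\<close>)
    moreover have "(\<lambda>n. padic_abs p (Y' p n * (X p n - X' p n))) \<longlonglongrightarrow> 0"
      by (rule padic_null_mult[OF p]) (use h p in \<open>auto simp: fadele_rel_def fadele_rep_def\<close>)
    ultimately show ?thesis
      using padic_null_add[OF p, of "\<lambda>n. X p n * (Y p n - Y' p n)" "\<lambda>n. Y' p n * (X p n - X' p n)"]
      by (simp add: algebra_simps)
  qed
  then show "fadele_rel (\<lambda>p n. X p n * Y p n) (\<lambda>p n. X' p n * Y' p n)"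
    using h by (simp add: fadele_rel_def fadele_rep_mult)
qed

instance
proof
  show "(0 :: fadele) \<noteq> 1"
  proof (transfer, rule notI)
    assume "fadele_rel (\<lambda>_ _. 0) (\<lambda>_ _. 1)"
    then have "(\<lambda>n::nat. padic_abs 2 (0 - 1)) \<longlonglongrightarrow> 0"
      unfolding fadele_rel_def using two_is_prime_nat by blast
    then show False by (simp add: LIMSEQ_const_iff)
  qed
  show "a - b = a + - b" for a b :: fadele by (rule minus_fadele_def)
  fix a b c :: fadele
  show "a * b * c = a * (b * c)"
    by transfer (simp add: mult.assoc fadele_rel_refl fadele_rel_repD fadele_rep_mult)
  show "a * b = b * a"
    by transfer (simp add: mult.commute fadele_rel_refl fadele_rel_repD fadele_rep_mult)
  show "1 * a = a"
    by transfer simp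
  show "a + b + c = a + (b + c)"
    by transfer (simp add: add.assoc fadele_rel_refl fadele_rel_repD fadele_rep_add)
  show "a + b = b + a"
    by transfer (simp add: add.commute fadele_rel_refl fadele_rel_repD fadele_rep_add)
  show "0 + a = a"
    by transfer simp
  show "- a + a = 0"
    by transfer (simp add: fadele_rel_refl fadele_rep_const)
  show "(a + b) * c = a * c + b * c"
    by transfer (simp add: distrib_right fadele_rel_refl fadele_rel_repD fadele_rep_add fadele_rep_mult)
qed

end

lift_definition fadele_abs :: "nat \<Rightarrow> fadele \<Rightarrow> real" is
  "\<lambda>p X. if prime p then lim (\<lambda>n. padic_abs p (X p n)) else 0"
proof -
  fix p X Y assume h: "fadele_rel X Y"
  show "(if prime p then lim (\<lambda>n. padic_abs p (X p n)) else 0)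
      = (if prime p then lim (\<lambda>n. padic_abs p (Y p n)) else 0)"
  proof (cases "prime p")
    case True
    have "(\<lambda>n. padic_abs p (X p n) - padic_abs p (Y p n)) \<longlonglongrightarrow> 0"
    proof (rule Lim_null_comparison)
      show "\<forall>\<^sub>F n in sequentially. norm (padic_abs p (X p n) - padic_abs p (Y p n))
          \<le> padic_abs p (X p n - Y p n)"
      proof (rule always_eventually, rule allI)
        fix n
        have "padic_abs p (Y p n - X p n) = padic_abs p (X p n - Y p n)"
          by (metis minus_diff_eq padic_abs_minus)
        then show "norm (padic_abs p (X p n) - padic_abs p (Y p n)) \<le> padic_abs p (X p n - Y p n)"
          using padic_abs_triangle[OF True, of "X p n - Y p n" "Y p n"]
            padic_abs_triangle[OF True, of "Y p n - X p n" "X p n"] by simp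
      qed
    qed (use h True in \<open>simp add: fadele_rel_def\<close>)
    then have "(\<lambda>n. padic_abs p (X p n)) \<longlonglongrightarrow> l \<longleftrightarrow> (\<lambda>n. padic_abs p (Y p n)) \<longlonglongrightarrow> l" for l
      by (rule Lim_transform_eq)
    then show ?thesis by (simp add: lim_def)
  qed simp
qed

text \<open>The restricted product topology: a neighbourhood basis of x is given by products of closed
  p-adic balls around x, almost all of radius 1.\<close>

instantiation fadele :: topological_space
begin

definition open_fadele :: "fadele set \<Rightarrow> bool" where
  "open_fadele U \<longleftrightarrow> (\<forall>x\<in>U. \<exists>e :: nat \<Rightarrow> real.
     (\<forall>p. prime p \<longrightarrow> 0 < e p) \<and> finite {p. prime p \<and> e p \<noteq> 1} \<and>
     {y. \<forall>p. prime p \<longrightarrow> fadele_abs p (y - x) \<le> e p} \<subseteq> U)"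

instance
proof
  show "open (UNIV :: fadele set)"
    unfolding open_fadele_def by (intro ballI exI[of _ "\<lambda>_. 1"]) auto
next
  fix S T :: "fadele set" assume S: "open S" and T: "open T"
  show "open (S \<inter> T)" unfolding open_fadele_def
  proof safe
    fix x assume "x \<in> S" "x \<in> T"
    then obtain d e where d: "\<forall>p. prime p \<longrightarrow> 0 < (d p :: real)" "finite {p. prime p \<and> d p \<noteq> 1}"
        "{y. \<forall>p. prime p \<longrightarrow> fadele_abs p (y - x) \<le> d p} \<subseteq> S"
      and e: "\<forall>p. prime p \<longrightarrow> 0 < (e p :: real)" "finite {p. prime p \<and> e p \<noteq> 1}"
        "{y. \<forall>p. prime p \<longrightarrow> fadele_abs p (y - x) \<le> e p} \<subseteq> T"
      using S T unfolding open_fadele_def by meson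
    have "finite {p. prime p \<and> min (d p) (e p) \<noteq> 1}"
      by (rule finite_subset[of _ "{p. prime p \<and> d p \<noteq> 1} \<union> {p. prime p \<and> e p \<noteq> 1}"])
         (use d e in auto)
    moreover have "{y. \<forall>p. prime p \<longrightarrow> fadele_abs p (y - x) \<le> min (d p) (e p)} \<subseteq> S \<inter> T"
      using d(3) e(3) by auto
    ultimately show "\<exists>e. (\<forall>p. prime p \<longrightarrow> 0 < (e p :: real)) \<and> finite {p. prime p \<and> e p \<noteq> 1} \<and>
        {y. \<forall>p. prime p \<longrightarrow> fadele_abs p (y - x) \<le> e p} \<subseteq> S \<inter> T"
      using d(1) e(1) by (intro exI[of _ "\<lambda>p. min (d p) (e p)"]) auto
  qed
next
  fix \<K> :: "fadele set set" assume *: "\<forall>S\<in>\<K>. open S"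
  show "open (\<Union>\<K>)" unfolding open_fadele_def
  proof safe
    fix x S assume S: "S \<in> \<K>" "x \<in> S"
    then obtain e where "\<forall>p. prime p \<longrightarrow> 0 < (e p :: real)" "finite {p. prime p \<and> e p \<noteq> 1}"
        "{y. \<forall>p. prime p \<longrightarrow> fadele_abs p (y - x) \<le> e p} \<subseteq> S"
      using * unfolding open_fadele_def by meson
    then show "\<exists>e. (\<forall>p. prime p \<longrightarrow> 0 < (e p :: real)) \<and> finite {p. prime p \<and> e p \<noteq> 1} \<and>
        {y. \<forall>p. prime p \<longrightarrow> fadele_abs p (y - x) \<le> e p} \<subseteq> \<Union>\<K>"
      using S by (intro exI[of _ e]) auto
  qed
qed

end

class rat_algebra = comm_ring_1 +
  fixes rat_incl :: "rat \<Rightarrow> 'a"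
  assumes rat_incl_1: "rat_incl 1 = 1"
    and rat_incl_add: "rat_incl (x + y) = rat_incl x + rat_incl y"
    and rat_incl_mult: "rat_incl (x * y) = rat_incl x * rat_incl y"

instantiation rat :: rat_algebra
begin
definition rat_incl_rat :: "rat \<Rightarrow> rat" where "rat_incl_rat q = q"
instance by standard (simp_all add: rat_incl_rat_def)
end

instantiation real :: rat_algebra
begin
definition rat_incl_real :: "rat \<Rightarrow> real" where "rat_incl_real = of_rat"
instance by standard (simp_all add: rat_incl_real_def of_rat_add of_rat_mult)
end

instantiation complex :: rat_algebra
begin
definition rat_incl_complex :: "rat \<Rightarrow> complex" where "rat_incl_complex = of_rat"
instance by standard (simp_all add: rat_incl_complex_def of_rat_add of_rat_mult)
end

instantiation fadele :: rat_algebra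
begin
lift_definition rat_incl_fadele :: "rat \<Rightarrow> fadele" is "\<lambda>q _ _. q"
  by (simp add: fadele_rel_def fadele_rep_const)
instance
  by standard (transfer; simp add: fadele_rel_def fadele_rep_const)+
end


definition adele_abs :: "fadele \<times> real \<Rightarrow> real" where
  "adele_abs x = (\<Prod>p | prime p \<and> fadele_abs p (fst x) \<noteq> 1. fadele_abs p (fst x)) * \<bar>snd x\<bar>"

section \<open>Linear algebraic groups over the rationals\<close>

definition gl :: "('a::comm_ring_1 ^ 'n ^ 'n) monoid" where
  "gl = \<lparr>carrier = {g. invertible g}, mult = (**), one = mat 1\<rparr>"

text \<open>Polynomials in the matrix entries (variables \<open>Some (i, j)\<close>) and in the inverse of the
  determinant (variable \<open>None\<close>): the coordinate ring of the general linear group.\<close>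

type_synonym ('n, 'c) gl_poly = "(('n \<times> 'n) option \<Rightarrow>\<^sub>0 nat) \<Rightarrow>\<^sub>0 'c"

definition gl_coord :: "'a::comm_ring_1 ^ 'n ^ 'n \<Rightarrow> ('n \<times> 'n) option \<Rightarrow> 'a" where
  "gl_coord g v = (case v of None \<Rightarrow> det (matrix_inv g) | Some (i, j) \<Rightarrow> g $ i $ j)"

definition gl_eval :: "('c \<Rightarrow> 'a) \<Rightarrow> ('n, 'c::zero) gl_poly \<Rightarrow> 'a::comm_ring_1 ^ 'n ^ 'n \<Rightarrow> 'a" where
  "gl_eval \<phi> p g = (\<Sum>m\<in>Poly_Mapping.keys p. \<phi> (Poly_Mapping.lookup p m) *
     (\<Prod>v\<in>Poly_Mapping.keys m. gl_coord g v ^ Poly_Mapping.lookup m v))"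

abbreviation qeval :: "('n, rat) gl_poly \<Rightarrow> 'a::rat_algebra ^ 'n ^ 'n \<Rightarrow> 'a" where
  "qeval \<equiv> gl_eval rat_incl"

definition zariski :: "(complex ^ 'n ^ 'n) topology" where
  "zariski = topology_generated_by
     (range (\<lambda>p :: ('n, complex) gl_poly. {g. invertible g \<and> gl_eval id p g \<noteq> 0}))"

text \<open>An algebraic group over the rationals is identified with its group of complex points, on
  which it is recovered from the rational polynomials vanishing there.\<close>

definition vanishing_ideal :: "(complex ^ 'n ^ 'n) set \<Rightarrow> ('n, rat) gl_poly set" where
  "vanishing_ideal H = {p. \<forall>g\<in>H. qeval p g = 0}"

definition pts :: "(complex ^ 'n ^ 'n) set \<Rightarrow> ('a::rat_algebra ^ 'n ^ 'n) set" where
  "pts H = {g. invertible g \<and> (\<forall>p\<in>vanishing_ideal H. qeval p g = 0)}"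

text \<open>In characteristic 0, a Zariski closed set cut out by rational polynomials is defined over
  the rationals.\<close>

definition q_group :: "(complex ^ 'n ^ 'n) set \<Rightarrow> bool" where
  "q_group H \<longleftrightarrow> subgroup H gl \<and> pts H = H"

definition unipotent :: "'a::comm_ring_1 ^ 'n ^ 'n \<Rightarrow> bool" where
  "unipotent g \<longleftrightarrow> (\<exists>k. (((**) (g - mat 1)) ^^ k) (mat 1) = 0)"

text \<open>The union is itself the largest connected normal unipotent closed subgroup.\<close>

definition unipotent_radical :: "(complex ^ 'n ^ 'n) set \<Rightarrow> (complex ^ 'n ^ 'n) set" where
  "unipotent_radical H = \<Union>{N. N \<lhd> gl\<lparr>carrier := H\<rparr> \<and> closedin zariski N \<and>
     connectedin zariski N \<and> (\<forall>g\<in>N. unipotent g)}"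

definition connected_reductive :: "(complex ^ 'n ^ 'n) set \<Rightarrow> bool" where
  "connected_reductive G \<longleftrightarrow>
     q_group G \<and> connectedin zariski G \<and> unipotent_radical G = {mat 1}"

definition connected_solvable :: "(complex ^ 'n ^ 'n) set \<Rightarrow> bool" where
  "connected_solvable B \<longleftrightarrow> subgroup B gl \<and> closedin zariski B \<and> connectedin zariski B \<and>
     solvable (gl\<lparr>carrier := B\<rparr>)"

definition borel_subgroup :: "(complex ^ 'n ^ 'n) set \<Rightarrow> (complex ^ 'n ^ 'n) set \<Rightarrow> bool" where
  "borel_subgroup G B \<longleftrightarrow> B \<subseteq> G \<and> connected_solvable B \<and>
     (\<forall>B'. B \<subseteq> B' \<and> B' \<subseteq> G \<and> connected_solvable B' \<longrightarrow> B' = B)"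

definition parabolic :: "(complex ^ 'n ^ 'n) set \<Rightarrow> (complex ^ 'n ^ 'n) set \<Rightarrow> bool" where
  "parabolic G P \<longleftrightarrow> q_group P \<and> P \<subseteq> G \<and> (\<exists>B. borel_subgroup G B \<and> B \<subseteq> P)"

definition minimal_parabolic :: "(complex ^ 'n ^ 'n) set \<Rightarrow> (complex ^ 'n ^ 'n) set \<Rightarrow> bool" where
  "minimal_parabolic G P \<longleftrightarrow> parabolic G P \<and> (\<forall>P'. parabolic G P' \<and> P' \<subseteq> P \<longrightarrow> P' = P)"

definition levi_component :: "(complex ^ 'n ^ 'n) set \<Rightarrow> (complex ^ 'n ^ 'n) set \<Rightarrow> bool" where
  "levi_component P L \<longleftrightarrow> q_group L \<and> L \<subseteq> P \<and> L \<inter> unipotent_radical P = {mat 1} \<and>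
     L <#>\<^bsub>gl\<^esub> unipotent_radical P = P"

definition qchars :: "(complex ^ 'n ^ 'n) set \<Rightarrow> ('n, rat) gl_poly set" where
  "qchars H = {\<psi>. qeval \<psi> (mat 1 :: complex ^ 'n ^ 'n) = 1 \<and>
     (\<forall>g\<in>H. \<forall>h\<in>H. qeval \<psi> (g ** h) = qeval \<psi> g * qeval \<psi> h)}"

section \<open>Adelic points\<close>

text \<open>The adele ring is the product of the finite adeles and the reals, so adelic points are pairs
  (finite component, real component).\<close>

type_synonym 'n adele_mat = "(fadele ^ 'n ^ 'n) \<times> (real ^ 'n ^ 'n)"

definition adele_gl :: "'n::finite adele_mat monoid" where
  "adele_gl = gl \<times>\<times> gl"

definition adele_pts :: "(complex ^ 'n ^ 'n) set \<Rightarrow> 'n adele_mat set" where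
  "adele_pts H = pts H \<times> pts H"

definition diag_incl :: "rat ^ 'n ^ 'n \<Rightarrow> 'n adele_mat" where
  "diag_incl g = (map_matrix rat_incl g, map_matrix rat_incl g)"

definition char_abs :: "('n::finite, rat) gl_poly \<Rightarrow> 'n adele_mat \<Rightarrow> real" where
  "char_abs \<psi> x = adele_abs (qeval \<psi> (fst x), qeval \<psi> (snd x))"

definition adele_pts1 :: "(complex ^ 'n ^ 'n) set \<Rightarrow> 'n adele_mat set" where
  "adele_pts1 H = {x \<in> adele_pts H. \<forall>\<psi>\<in>qchars H. char_abs \<psi> x = 1}"

definition real_pts1 :: "(complex ^ 'n ^ 'n) set \<Rightarrow> (real ^ 'n ^ 'n) set" where
  "real_pts1 H = {g \<in> pts H. \<forall>\<psi>\<in>qchars H. \<bar>qeval \<psi> g\<bar> = 1}"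

text \<open>Over the finite adeles, inversion is not continuous for the subspace topology of the matrix
  space, hence the embedding by the matrix and its inverse.\<close>

definition pts_top ::
    "(complex ^ 'n ^ 'n) set \<Rightarrow> ('a::{rat_algebra, topological_space} ^ 'n ^ 'n) topology" where
  "pts_top H = pullback_topology (pts H) (\<lambda>g. (g, matrix_inv g)) euclidean"

definition adele_top :: "(complex ^ 'n ^ 'n) set \<Rightarrow> 'n adele_mat topology" where
  "adele_top H = prod_topology (pts_top H) (pts_top H)"

definition adele_top1 :: "(complex ^ 'n ^ 'n) set \<Rightarrow> 'n adele_mat topology" where
  "adele_top1 H = subtopology (adele_top H) (adele_pts1 H)"

section \<open>Test functions\<close>

fun ck_on :: "nat \<Rightarrow> 'a::real_normed_vector set \<Rightarrow> ('a \<Rightarrow> 'b::real_normed_vector) \<Rightarrow> bool" where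
  "ck_on 0 V \<phi> \<longleftrightarrow> continuous_on V \<phi>"
| "ck_on (Suc k) V \<phi> \<longleftrightarrow> (\<forall>x\<in>V. \<phi> differentiable at x) \<and>
     (\<forall>v. ck_on k V (\<lambda>x. frechet_derivative \<phi> (at x) v))"

definition test_function :: "(complex ^ 'n ^ 'n) set \<Rightarrow> ('n adele_mat \<Rightarrow> complex) \<Rightarrow> bool" where
  "test_function G f \<longleftrightarrow>
     compactin (adele_top1 G) (adele_top1 G closure_of {x \<in> adele_pts1 G. f x \<noteq> 0}) \<and>
     (\<forall>x\<in>adele_pts1 G. \<exists>U V \<phi>. openin (pts_top G) U \<and> fst x \<in> U \<and> open V \<and> snd x \<in> V \<and>
        (\<forall>k. ck_on k V \<phi>) \<and>
        (\<forall>y\<in>adele_pts1 G. fst y \<in> U \<and> snd y \<in> V \<longrightarrow> f y = \<phi> (snd y)))"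

definition compact_open_subgroup ::
    "(complex ^ 'n ^ 'n) set \<Rightarrow> (fadele ^ 'n ^ 'n) set \<Rightarrow> bool" where
  "compact_open_subgroup G K \<longleftrightarrow>
     subgroup K gl \<and> compactin (pts_top G) K \<and> openin (pts_top G) K"

definition parabolically_regular ::
    "(complex ^ 'n ^ 'n) set \<Rightarrow> ('n adele_mat \<Rightarrow> complex) \<Rightarrow> bool" where
  "parabolically_regular G f \<longleftrightarrow> (\<exists>K. compact_open_subgroup G K \<and>
     (\<forall>x\<in>adele_pts1 G. f x \<noteq> 0 \<longrightarrow> x \<in> K \<times> real_pts1 G) \<and>
     (\<forall>P. parabolic G P \<and> P \<noteq> G \<longrightarrow>
        (\<forall>g\<in>pts G. \<forall>x \<in> K \<times> real_pts1 P. f (fst x, g ** snd x ** matrix_inv g) = 0)))"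

section \<open>Equivalence classes of rational points\<close>

definition semisimple :: "rat ^ 'n ^ 'n \<Rightarrow> bool" where
  "semisimple s \<longleftrightarrow> (\<exists>c :: complex ^ 'n ^ 'n. invertible c \<and>
     (\<forall>i j. i \<noteq> j \<longrightarrow> (c ** map_matrix of_rat s ** matrix_inv c) $ i $ j = 0))"

definition jordan_decomposition ::
    "rat ^ 'n ^ 'n \<Rightarrow> rat ^ 'n ^ 'n \<Rightarrow> rat ^ 'n ^ 'n \<Rightarrow> bool" where
  "jordan_decomposition g s u \<longleftrightarrow> semisimple s \<and> unipotent u \<and> g = s ** u \<and> s ** u = u ** s"

definition ss_equiv :: "(complex ^ 'n ^ 'n) set \<Rightarrow> ((rat ^ 'n ^ 'n) \<times> (rat ^ 'n ^ 'n)) set" where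
  "ss_equiv G = {(g, h). g \<in> pts G \<and> h \<in> pts G \<and>
     (\<exists>s u s' u'. jordan_decomposition g s u \<and> jordan_decomposition h s' u' \<and>
        (\<exists>d\<in>pts G. s' = d ** s ** matrix_inv d))}"

definition elliptic :: "(complex ^ 'n ^ 'n) set \<Rightarrow> rat ^ 'n ^ 'n \<Rightarrow> bool" where
  "elliptic G g \<longleftrightarrow> g \<in> pts G \<and> (\<forall>P. parabolic G P \<and> P \<noteq> G \<longrightarrow> g \<notin> pts P)"

definition elliptic_class :: "(complex ^ 'n ^ 'n) set \<Rightarrow> (rat ^ 'n ^ 'n) set \<Rightarrow> bool" where
  "elliptic_class G \<oo> \<longleftrightarrow> (\<exists>g\<in>\<oo>. elliptic G g)"

section \<open>Split tori, roots and weights\<close>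

text \<open>An isomorphism onto the d-th power of the multiplicative group, given by its components;
  in characteristic 0 a bijective homomorphism of algebraic groups is an isomorphism.\<close>

definition split_torus :: "nat \<Rightarrow> (complex ^ 'n ^ 'n) set \<Rightarrow> bool" where
  "split_torus d A \<longleftrightarrow> q_group A \<and> (\<exists>\<psi>. (\<forall>i<d. \<psi> i \<in> qchars A) \<and>
     bij_betw (\<lambda>a. map (\<lambda>i. qeval (\<psi> i) a) [0..<d]) A {z. length z = d \<and> 0 \<notin> set z})"

definition torus_dim :: "(complex ^ 'n ^ 'n) set \<Rightarrow> nat" where
  "torus_dim A = (THE d. split_torus d A)"

text \<open>The union is itself the largest split torus in the center.\<close>

definition split_center :: "(complex ^ 'n ^ 'n) set \<Rightarrow> (complex ^ 'n ^ 'n) set" where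
  "split_center L = \<Union>{A. (\<exists>d. split_torus d A) \<and> A \<subseteq> {z \<in> L. \<forall>g\<in>L. z ** g = g ** z}}"

definition char_fun ::
    "(complex ^ 'n ^ 'n) set \<Rightarrow> ('n, rat) gl_poly \<Rightarrow> complex ^ 'n ^ 'n \<Rightarrow> complex" where
  "char_fun A \<psi> = restrict (qeval \<psi>) A"

definition chars :: "(complex ^ 'n ^ 'n) set \<Rightarrow> (complex ^ 'n ^ 'n \<Rightarrow> complex) set" where
  "chars A = char_fun A ` qchars A"

definition char_mult ::
    "(complex ^ 'n ^ 'n) set \<Rightarrow> (complex ^ 'n ^ 'n \<Rightarrow> complex) \<Rightarrow> (complex ^ 'n ^ 'n \<Rightarrow> complex)
      \<Rightarrow> complex ^ 'n ^ 'n \<Rightarrow> complex" where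
  "char_mult A \<alpha> \<beta> = restrict (\<lambda>a. \<alpha> a * \<beta> a) A"

type_synonym 'n coweight = "(complex ^ 'n ^ 'n \<Rightarrow> complex) \<Rightarrow> real"

text \<open>The real vector space of additive maps from the character group of A to the reals. The
  pairing of a character and a coweight is application.\<close>

definition coweights :: "(complex ^ 'n ^ 'n) set \<Rightarrow> 'n coweight set" where
  "coweights A = {X. (\<forall>\<psi>. \<psi> \<notin> chars A \<longrightarrow> X \<psi> = 0) \<and>
     (\<forall>\<alpha>\<in>chars A. \<forall>\<beta>\<in>chars A. X (char_mult A \<alpha> \<beta>) = X \<alpha> + X \<beta>)}"

text \<open>The tangent space at the identity, as a space of matrices.\<close>

definition lie_algebra :: "(complex ^ 'n ^ 'n) set \<Rightarrow> (complex ^ 'n ^ 'n) set" where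
  "lie_algebra H = {X. \<forall>p\<in>vanishing_ideal H.
     ((\<lambda>t. qeval p (mat 1 + mat t ** X)) has_field_derivative 0) (at 0)}"

definition roots ::
    "(complex ^ 'n ^ 'n) set \<Rightarrow> (complex ^ 'n ^ 'n) set \<Rightarrow> (complex ^ 'n ^ 'n \<Rightarrow> complex) set" where
  "roots A H = {\<alpha> \<in> chars A. \<alpha> \<noteq> restrict (\<lambda>_. 1) A \<and>
     (\<exists>X\<in>lie_algebra H. X \<noteq> 0 \<and> (\<forall>a\<in>A. a ** X ** matrix_inv a = mat (\<alpha> a) ** X))}"

text \<open>Here N is the unipotent radical of a minimal parabolic subgroup and A the maximal split
  torus in the center of its Levi component.\<close>

definition simple_roots ::
    "(complex ^ 'n ^ 'n) set \<Rightarrow> (complex ^ 'n ^ 'n) set \<Rightarrow> (complex ^ 'n ^ 'n \<Rightarrow> complex) set" where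
  "simple_roots A N = {\<alpha> \<in> roots A N. \<not> (\<exists>\<beta>\<in>roots A N. \<exists>\<gamma>\<in>roots A N. \<alpha> = char_mult A \<beta> \<gamma>)}"

text \<open>The coroot is determined by the reflection \<open>\<psi> \<mapsto> \<psi> - \<langle>\<psi>, \<alpha>\<^sup>\<or>\<rangle> \<alpha>\<close> in the Weyl group, which is
  induced by conjugation with an element w normalizing A.\<close>

definition coroot ::
    "(complex ^ 'n ^ 'n) set \<Rightarrow> (complex ^ 'n ^ 'n) set \<Rightarrow> (complex ^ 'n ^ 'n \<Rightarrow> complex)
      \<Rightarrow> 'n coweight" where
  "coroot G A \<alpha> = (THE X. X \<in> coweights A \<and> X \<alpha> = 2 \<and>
     (\<exists>w\<in>G. (\<lambda>a. w ** a ** matrix_inv w) ` A = A \<and>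
        (\<forall>\<psi>\<in>chars A. \<exists>m::int. X \<psi> = of_int m \<and>
           (\<forall>a\<in>A. \<psi> (w ** a ** matrix_inv w) = \<psi> a * \<alpha> a powi (- m)))))"

text \<open>Fundamental weights: the linear forms on the coweight space of A that vanish on the coweight
  space of the maximal split torus \<open>split_center G\<close> in the center of G and are dual to the
  coroots of the set \<open>\<Delta>\<close> of simple roots.\<close>

definition fundamental_weight ::
    "(complex ^ 'n ^ 'n) set \<Rightarrow> (complex ^ 'n ^ 'n) set \<Rightarrow> (complex ^ 'n ^ 'n \<Rightarrow> complex) set
      \<Rightarrow> (complex ^ 'n ^ 'n \<Rightarrow> complex) \<Rightarrow> 'n coweight \<Rightarrow> real" where
  "fundamental_weight G A \<Delta> \<alpha> = (THE \<omega>.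
     (\<forall>X. X \<notin> coweights A \<longrightarrow> \<omega> X = 0) \<and>
     (\<forall>X\<in>coweights A. \<forall>Y\<in>coweights A. \<forall>c. \<omega> (\<lambda>\<psi>. c * X \<psi> + Y \<psi>) = c * \<omega> X + \<omega> Y) \<and>
     (\<forall>X\<in>coweights A. (\<forall>\<psi>\<in>chars A. (\<forall>a\<in>split_center G. \<psi> a = 1) \<longrightarrow> X \<psi> = 0) \<longrightarrow> \<omega> X = 0) \<and>
     (\<forall>\<beta>\<in>\<Delta>. \<omega> (coroot G A \<beta>) = (if \<beta> = \<alpha> then 1 else 0)))"

section \<open>Invariant measures\<close>

definition borel_radon :: "'a topology \<Rightarrow> 'a measure \<Rightarrow> bool" where
  "borel_radon X M \<longleftrightarrow> space M = topspace X \<and> sets M = sigma_sets (topspace X) {U. openin X U} \<and>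
     (\<forall>C. compactin X C \<longrightarrow> emeasure M C < \<infinity>) \<and>
     (\<forall>U. openin X U \<and> U \<noteq> {} \<longrightarrow> emeasure M U > 0)"

text \<open>The Haar measure of the adelic points of a unipotent group N, normalized such that the
  quotient by the rational points, that is a fundamental domain F, has volume 1.\<close>

definition unipotent_haar :: "(complex ^ 'n ^ 'n) set \<Rightarrow> 'n adele_mat measure \<Rightarrow> bool" where
  "unipotent_haar N M \<longleftrightarrow> borel_radon (adele_top N) M \<and>
     (\<forall>x\<in>adele_pts N. \<forall>B\<in>sets M. emeasure M ((\<lambda>y. x \<otimes>\<^bsub>adele_gl\<^esub> y) ` B) = emeasure M B) \<and>
     (\<exists>F\<in>sets M. emeasure M F = 1 \<and>
        (\<forall>x\<in>adele_pts N. \<exists>!\<gamma>. \<gamma> \<in> pts N \<and> diag_incl \<gamma> \<otimes>\<^bsub>adele_gl\<^esub> x \<in> F))"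

definition adelic_quotient :: "(complex ^ 'n ^ 'n) set \<Rightarrow> 'n adele_mat set set" where
  "adelic_quotient G = rcosets\<^bsub>adele_gl\<lparr>carrier := adele_pts1 G\<rparr>\<^esub> (diag_incl ` pts G)"

definition quotient_top :: "(complex ^ 'n ^ 'n) set \<Rightarrow> 'n adele_mat set topology" where
  "quotient_top G = topology (\<lambda>U. U \<subseteq> adelic_quotient G \<and> openin (adele_top1 G)
     {x \<in> adele_pts1 G. (diag_incl ` pts G) #>\<^bsub>adele_gl\<^esub> x \<in> U})"

definition quotient_measure ::
    "(complex ^ 'n ^ 'n) set \<Rightarrow> 'n adele_mat set measure \<Rightarrow> bool" where
  "quotient_measure G M \<longleftrightarrow> borel_radon (quotient_top G) M \<and>
     (\<forall>g\<in>adele_pts1 G. \<forall>B\<in>sets M. emeasure M ((\<lambda>C. C #>\<^bsub>adele_gl\<^esub> g) ` B) = emeasure M B)"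

section \<open>Arthur's distributions\<close>

definition rep :: "'a set \<Rightarrow> 'a" where
  "rep C = (SOME x. x \<in> C)"

definition maximal_compact :: "(complex ^ 'n ^ 'n) set \<Rightarrow> 'n adele_mat set \<Rightarrow> bool" where
  "maximal_compact G K \<longleftrightarrow> subgroup K adele_gl \<and> compactin (adele_top G) K \<and>
     (\<forall>K'. subgroup K' adele_gl \<and> compactin (adele_top G) K' \<and> K \<subseteq> K' \<longrightarrow> K' = K)"

text \<open>The parameter \<open>lev\<close> assigns to each standard parabolic subgroup its Levi component
  containing \<open>L\<^sub>0\<close>, and \<open>\<nu>\<close> the Haar measure of its unipotent radical.\<close>

locale arthur_setting =
  fixes G P\<^sub>0 L\<^sub>0 :: "(complex ^ 'n ^ 'n) set"
    and K :: "'n adele_mat set"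
    and lev :: "(complex ^ 'n ^ 'n) set \<Rightarrow> (complex ^ 'n ^ 'n) set"
    and T :: "'n coweight"
    and \<nu> :: "(complex ^ 'n ^ 'n) set \<Rightarrow> 'n adele_mat measure"
    and \<mu> :: "'n adele_mat set measure"
  assumes minimal_parabolic: "minimal_parabolic G P\<^sub>0"
    and levi_P0: "levi_component P\<^sub>0 L\<^sub>0"
    and maximal_compact: "maximal_compact G K"
    and iwasawa: "adele_pts G = adele_pts P\<^sub>0 <#>\<^bsub>adele_gl\<^esub> K"
    and lev: "\<And>P. parabolic G P \<Longrightarrow> P\<^sub>0 \<subseteq> P \<Longrightarrow> levi_component P (lev P) \<and> L\<^sub>0 \<subseteq> lev P"
    and T: "T \<in> coweights (split_center L\<^sub>0)"
      "\<And>\<alpha>. \<alpha> \<in> simple_roots (split_center L\<^sub>0) (unipotent_radical P\<^sub>0) \<Longrightarrow> T \<alpha> > 0"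
    and haar: "\<And>P. parabolic G P \<Longrightarrow> P\<^sub>0 \<subseteq> P \<Longrightarrow> unipotent_haar (unipotent_radical P) (\<nu> P)"
    and quotient_measure: "quotient_measure G \<mu>"
begin

definition A\<^sub>0 :: "(complex ^ 'n ^ 'n) set" where
  "A\<^sub>0 = split_center L\<^sub>0"

definition \<Delta>\<^sub>0 :: "(complex ^ 'n ^ 'n \<Rightarrow> complex) set" where
  "\<Delta>\<^sub>0 = simple_roots A\<^sub>0 (unipotent_radical P\<^sub>0)"

definition height :: "'n adele_mat \<Rightarrow> 'n coweight" where
  "height x = (THE X. X \<in> coweights A\<^sub>0 \<and>
     (\<exists>n\<in>adele_pts (unipotent_radical P\<^sub>0). \<exists>l\<in>adele_pts L\<^sub>0. \<exists>k\<in>K.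
        x = n \<otimes>\<^bsub>adele_gl\<^esub> l \<otimes>\<^bsub>adele_gl\<^esub> k \<and>
        (\<forall>\<psi>\<in>qchars L\<^sub>0. X (char_fun A\<^sub>0 \<psi>) = ln (char_abs \<psi> l))))"

text \<open>The fundamental weights attached to P are those belonging to the simple roots that are not
  roots of the Levi component of P.\<close>

definition weights :: "(complex ^ 'n ^ 'n) set \<Rightarrow> ('n coweight \<Rightarrow> real) set" where
  "weights P = fundamental_weight G A\<^sub>0 \<Delta>\<^sub>0 ` (\<Delta>\<^sub>0 - roots A\<^sub>0 (lev P))"

definition tau_hat :: "(complex ^ 'n ^ 'n) set \<Rightarrow> 'n coweight \<Rightarrow> real" where
  "tau_hat P X = (if \<forall>\<omega>\<in>weights P. \<omega> X > 0 then 1 else 0)"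

definition kernel ::
    "('n adele_mat \<Rightarrow> complex) \<Rightarrow> (rat ^ 'n ^ 'n) set \<Rightarrow> (complex ^ 'n ^ 'n) set
      \<Rightarrow> 'n adele_mat \<Rightarrow> 'n adele_mat \<Rightarrow> complex" where
  "kernel f \<oo> P x y = (\<Sum>\<^sub>\<infinity>\<gamma> \<in> pts (lev P) \<inter> \<oo>.
     (\<integral>n. f (inv\<^bsub>adele_gl\<^esub> x \<otimes>\<^bsub>adele_gl\<^esub> diag_incl \<gamma> \<otimes>\<^bsub>adele_gl\<^esub> n \<otimes>\<^bsub>adele_gl\<^esub> y) \<partial>(\<nu> P)))"

definition truncated_kernel ::
    "('n adele_mat \<Rightarrow> complex) \<Rightarrow> (rat ^ 'n ^ 'n) set \<Rightarrow> 'n adele_mat \<Rightarrow> complex" where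
  "truncated_kernel f \<oo> x = (\<Sum>\<^sub>\<infinity>P | parabolic G P \<and> P\<^sub>0 \<subseteq> P.
     (-1) ^ (torus_dim (split_center (lev P)) - torus_dim (split_center G)) *
     (\<Sum>\<^sub>\<infinity>C \<in> rcosets\<^bsub>gl\<lparr>carrier := pts G\<rparr>\<^esub> (pts P).
        let y = diag_incl (rep C) \<otimes>\<^bsub>adele_gl\<^esub> x
        in kernel f \<oo> P y y * of_real (tau_hat P (\<lambda>\<psi>. height y \<psi> - T \<psi>))))"

definition J :: "('n adele_mat \<Rightarrow> complex) \<Rightarrow> (rat ^ 'n ^ 'n) set \<Rightarrow> complex" where
  "J f \<oo> = (\<integral>C. truncated_kernel f \<oo> (rep C) \<partial>\<mu>)"

end

end

theory Submission
  imports Defs "HOL-Computational_Algebra.Fundamental_Theorem_Algebra"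
begin

text \<open>Let \<open>P \<noteq> G\<close> be a parabolic subgroup with unipotent radical \<open>N\<close>, \<open>\<gamma>\<close> a rational point of \<open>P\<close>, and
  \<open>n\<close> an adelic point of \<open>N\<close>, and suppose that the value of \<open>f\<close> at \<open>x\<^sup>-\<^sup>1 \<gamma> n x\<close> is not 0. Then the finite
  part of \<open>\<gamma> n\<close> lies in a compact group, so every rational character \<open>\<psi>\<close> of \<open>P\<close>, being trivial on \<open>N\<close>,
  takes a value \<open>\<psi>(\<gamma>)\<close> that is a unit at every prime; by the product formula \<open>|\<psi>(\<gamma>)| = 1\<close> at the real
  place too. So the real part of \<open>\<gamma> n\<close> lies in \<open>P\<^sup>1\<close>, contradicting the regularity of \<open>f\<close>. Hence the
  kernels of all proper parabolic subgroups vanish, and so does every term of the kernel of \<open>G\<close>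
  that comes from a non-elliptic element.

  An algebraic group is given here by its complex points, so even the group law on its adelic points
  has to be derived: finitely many elements of a residue domain of a rational algebra embed into
  the complex numbers compatibly with all rational polynomial relations.\<close>

section \<open>Specialization to complex points\<close>

text \<open>Placed in the class context because the axiom of \<open>separated_algebra\<close> refers
  to it.\<close>

definition (in comm_ring_1) prime_ideal :: "'a set \<Rightarrow> bool" where
  "prime_ideal Z \<longleftrightarrow> 0 \<in> Z \<and> 1 \<notin> Z \<and> (\<forall>a\<in>Z. \<forall>b\<in>Z. a + b \<in> Z) \<and> (\<forall>r. \<forall>a\<in>Z. r * a \<in> Z) \<and>
     (\<forall>a b. a * b \<in> Z \<longrightarrow> a \<in> Z \<or> b \<in> Z)"

lemma prime_ideal_sum:
  assumes "prime_ideal Z" "\<And>i. i \<in> I \<Longrightarrow> f i \<in> Z"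
  shows "sum f I \<in> Z"
  using assms(2) by (induction I rule: infinite_finite_induct) (use assms(1) in \<open>auto simp: prime_ideal_def\<close>)

lemma prime_ideal_add_iff:
  assumes "prime_ideal Z" "b \<in> Z"
  shows "a + b \<in> Z \<longleftrightarrow> a \<in> Z"
proof
  assume "a + b \<in> Z"
  moreover have "(- 1) * b \<in> Z" using assms by (auto simp only: prime_ideal_def)
  ultimately have "a + b + (- 1) * b \<in> Z" using assms(1) by (auto simp only: prime_ideal_def)
  then show "a \<in> Z" by simp
qed (use assms in \<open>auto simp: prime_ideal_def\<close>)

lemma prime_ideal_mult_iff:
  assumes "prime_ideal Z"
  shows "a * b \<in> Z \<longleftrightarrow> a \<in> Z \<or> b \<in> Z"
  using assms unfolding prime_ideal_def by (metis mult.commute)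

lemma rat_incl_0 [simp]: "rat_incl 0 = (0 :: 'a::rat_algebra)"
  using rat_incl_add[of 0 0, where 'a = 'a] by simp

lemma rat_incl_minus: "rat_incl (- q) = - (rat_incl q :: 'a::rat_algebra)"
  using rat_incl_add[of "- q" q, where 'a = 'a] by (simp add: eq_neg_iff_add_eq_0)

text \<open>Such a relation is a rational subalgebra of the product of two algebras. It stands for a
  partial homomorphism whose domain grows with the relation, and it covers the inclusion of the
  rationals as well.\<close>

locale ring_relation =
  fixes \<rho> :: "('a::rat_algebra \<times> 'b::rat_algebra) set"
  assumes rel_rat: "(rat_incl q, rat_incl q) \<in> \<rho>"
    and rel_add: "(a, b) \<in> \<rho> \<Longrightarrow> (c, d) \<in> \<rho> \<Longrightarrow> (a + c, b + d) \<in> \<rho>"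
    and rel_mult: "(a, b) \<in> \<rho> \<Longrightarrow> (c, d) \<in> \<rho> \<Longrightarrow> (a * c, b * d) \<in> \<rho>"
begin

lemma rel_0: "(0, 0) \<in> \<rho>"
  using rel_rat[of 0] by simp

lemma rel_1: "(1, 1) \<in> \<rho>"
  using rel_rat[of 1] by (simp add: rat_incl_1)

lemma rel_uminus: "(a, b) \<in> \<rho> \<Longrightarrow> (- a, - b) \<in> \<rho>"
  using rel_mult[OF rel_rat[of "- 1"], of a b] by (simp add: rat_incl_minus rat_incl_1)

lemma rel_diff: "(a, b) \<in> \<rho> \<Longrightarrow> (c, d) \<in> \<rho> \<Longrightarrow> (a - c, b - d) \<in> \<rho>"
  using rel_add[of a b "- c" "- d"] rel_uminus by simp

lemma rel_sum: "(\<And>i. i \<in> I \<Longrightarrow> (f i, g i) \<in> \<rho>) \<Longrightarrow> (sum f I, sum g I) \<in> \<rho>"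
  by (induction I rule: infinite_finite_induct) (auto intro: rel_0 rel_add)

lemma rel_prod: "(\<And>i. i \<in> I \<Longrightarrow> (f i, g i) \<in> \<rho>) \<Longrightarrow> (prod f I, prod g I) \<in> \<rho>"
  by (induction I rule: infinite_finite_induct) (auto intro: rel_1 rel_mult)

lemma rel_power: "(a, b) \<in> \<rho> \<Longrightarrow> (a ^ k, b ^ k) \<in> \<rho>"
  by (induction k) (auto intro: rel_1 rel_mult)

section \<open>Polynomials with related coefficients\<close>

definition poly_rel :: "'a poly \<Rightarrow> 'b poly \<Rightarrow> bool" where
  "poly_rel P Q \<longleftrightarrow> (\<forall>i. (coeff P i, coeff Q i) \<in> \<rho>)"

lemma poly_rel_add: "poly_rel P Q \<Longrightarrow> poly_rel P' Q' \<Longrightarrow> poly_rel (P + P') (Q + Q')"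
  by (simp add: poly_rel_def rel_add)

lemma poly_rel_diff: "poly_rel P Q \<Longrightarrow> poly_rel P' Q' \<Longrightarrow> poly_rel (P - P') (Q - Q')"
  by (simp add: poly_rel_def rel_diff)

lemma poly_rel_mult: "poly_rel P Q \<Longrightarrow> poly_rel P' Q' \<Longrightarrow> poly_rel (P * P') (Q * Q')"
  by (auto simp: poly_rel_def coeff_mult intro!: rel_sum rel_mult)

lemma poly_rel_smult: "(a, b) \<in> \<rho> \<Longrightarrow> poly_rel P Q \<Longrightarrow> poly_rel (smult a P) (smult b Q)"
  by (simp add: poly_rel_def rel_mult)

lemma poly_rel_monom: "(a, b) \<in> \<rho> \<Longrightarrow> poly_rel (monom a k) (monom b k)"
  by (simp add: poly_rel_def rel_0)

lemma poly_rel_0: "poly_rel 0 0"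
  by (simp add: poly_rel_def rel_0)

lemma poly_rel_const: "(a, b) \<in> \<rho> \<Longrightarrow> poly_rel [:a:] [:b:]"
  by (auto simp: poly_rel_def coeff_pCons rel_0 split: nat.split)

lemma poly_rel_X: "poly_rel [:0, 1:] [:0, 1:]"
  by (auto simp: poly_rel_def coeff_pCons rel_0 rel_1 split: nat.split)

end

text \<open>Countability later leaves room in the complex numbers for an element transcendental over
  the image.\<close>

lemma (in ring_relation) countable_poly_rel:
  assumes "countable \<rho>"
  shows "countable {(P, Q). poly_rel P Q}"
proof -
  have "{(P, Q). poly_rel P Q} \<subseteq> (\<lambda>l. (Poly (map fst l), Poly (map snd l))) ` lists \<rho>"
  proof clarify
    fix P Q assume *: "poly_rel P Q"
    \<comment> \<open>Both coefficient lists are padded with zeros to a common length, so that they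
      are the projections of one list of pairs.\<close>
    define l where "l = map (\<lambda>i. (coeff P i, coeff Q i)) [0..<Suc (max (degree P) (degree Q))]"
    have 1: "nth_default 0 (map fst l) i = coeff P i" for i
      unfolding l_def by (simp add: nth_default_def coeff_eq_0 o_def del: upt_Suc)
    have 2: "nth_default 0 (map snd l) i = coeff Q i" for i
      unfolding l_def by (simp add: nth_default_def coeff_eq_0 o_def del: upt_Suc)
    have "P = Poly (map fst l)" "Q = Poly (map snd l)"
      using 1 2 by (auto simp: poly_eq_iff)
    moreover have "l \<in> lists \<rho>"
      using * by (auto simp: l_def poly_rel_def simp del: upt_Suc)
    ultimately show "(P, Q) \<in> (\<lambda>l. (Poly (map fst l), Poly (map snd l))) ` lists \<rho>" by blast
  qed
  then show ?thesis by (rule countable_subset) (use assms in auto)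
qed

text \<open>A ring relation that descends to an embedding into the complex numbers of a subring of the
  residue ring of a prime ideal.\<close>

locale residue_embedding = ring_relation \<rho> for \<rho> :: "('a::rat_algebra \<times> complex) set" +
  fixes Z :: "'a set"
  assumes prime: "prime_ideal Z"
    and rel_zero_iff: "(a, z) \<in> \<rho> \<Longrightarrow> a \<in> Z \<longleftrightarrow> z = 0"
begin

text \<open>\<open>P\<close> itself may be nonzero here: its coefficients are related to 0 and hence
  lie in \<open>Z\<close>.\<close>

lemma poly_rel_vanish:
  assumes "poly_rel P 0" shows "poly P a \<in> Z"
proof -
  have "coeff P i * a ^ i \<in> Z" for i
    using assms rel_zero_iff[of "coeff P i" 0] prime_ideal_mult_iff[OF prime] by (auto simp: poly_rel_def)
  then show ?thesis unfolding poly_altdef by (intro prime_ideal_sum[OF prime])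
qed

text \<open>Leading coefficients in a subring need not be invertible, so the dividend is first
  multiplied by a nonzero scalar. Both polynomials are divided in parallel, with degrees measured on
  the complex side, since the lifts may have further coefficients in \<open>Z\<close>.\<close>

lemma pseudo_division:
  assumes "poly_rel E\<^sub>0 E" "E \<noteq> 0" "poly_rel P Q"
  obtains e\<^sub>0 e A\<^sub>0 A R\<^sub>0 R where "(e\<^sub>0, e) \<in> \<rho>" "e \<noteq> 0" "poly_rel A\<^sub>0 A" "poly_rel R\<^sub>0 R"
    "smult e\<^sub>0 P = A\<^sub>0 * E\<^sub>0 + R\<^sub>0" "smult e Q = A * E + R" "R = 0 \<or> degree R < degree E"
proof -
  have "\<exists>e\<^sub>0 e A\<^sub>0 A R\<^sub>0 R. (e\<^sub>0, e) \<in> \<rho> \<and> e \<noteq> 0 \<and> poly_rel A\<^sub>0 A \<and> poly_rel R\<^sub>0 R \<and>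
    smult e\<^sub>0 P = A\<^sub>0 * E\<^sub>0 + R\<^sub>0 \<and> smult e Q = A * E + R \<and> (R = 0 \<or> degree R < degree E)"
    using assms(3)
  \<comment> \<open>The measure separates \<open>Q = 0\<close> from the nonzero constants, which
    also have degree 0.\<close>
  proof (induction "if Q = 0 then 0 else Suc (degree Q)" arbitrary: P Q rule: less_induct)
    case less
    show ?case
    proof (cases "Q = 0 \<or> degree Q < degree E")
      case True
      then show ?thesis
        by (intro exI[of _ 1] exI[of _ 0] exI[of _ P] exI[of _ Q])
           (use less.prems rel_1 poly_rel_0 in auto)
    next
      case False
      define k where "k = degree Q - degree E"
      \<comment> \<open>\<open>c\<close> and \<open>l\<close> are taken at the complex degrees: they
        are related to the leading coefficients of \<open>Q\<close> and \<open>E\<close>, but need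
        not be leading coefficients of \<open>P\<close> and \<open>E\<^sub>0\<close>.\<close>
      define c where "c = coeff P (degree Q)"
      define l where "l = coeff E\<^sub>0 (degree E)"
      define Q' where "Q' = smult (lead_coeff E) Q - monom (lead_coeff Q) k * E"
      define P' where "P' = smult l P - monom c k * E\<^sub>0"
      have lE: "(l, lead_coeff E) \<in> \<rho>" using assms(1) by (simp add: l_def poly_rel_def)
      have cQ: "(c, lead_coeff Q) \<in> \<rho>" using less.prems by (simp add: c_def poly_rel_def)
      have rel: "poly_rel P' Q'" unfolding P'_def Q'_def
        by (intro poly_rel_diff poly_rel_smult poly_rel_mult poly_rel_monom lE cQ assms less.prems)
      have "degree Q' \<le> degree Q" unfolding Q'_def
        by (rule degree_diff_le) (use False assms(2) in \<open>auto simp: degree_mult_eq degree_monom_eq k_def\<close>)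
      moreover have "coeff Q' (degree Q) = 0" unfolding Q'_def
        using False by (simp add: coeff_monom_mult k_def)
      ultimately have "Q' = 0 \<or> degree Q' < degree Q"
        by (metis le_neq_implies_less leading_coeff_0_iff)
      then have "(if Q' = 0 then 0 else Suc (degree Q')) < (if Q = 0 then 0 else Suc (degree Q))"
        using False by auto
      from less.hyps[OF this rel] obtain e\<^sub>0 e A\<^sub>0 A R\<^sub>0 R where IH: "(e\<^sub>0, e) \<in> \<rho>" "e \<noteq> 0"
        "poly_rel A\<^sub>0 A" "poly_rel R\<^sub>0 R" "smult e\<^sub>0 P' = A\<^sub>0 * E\<^sub>0 + R\<^sub>0" "smult e Q' = A * E + R"
        "R = 0 \<or> degree R < degree E" by blast
      have "smult (e\<^sub>0 * l) P = (A\<^sub>0 + smult e\<^sub>0 (monom c k)) * E\<^sub>0 + R\<^sub>0"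
        using IH(5) by (simp add: P'_def smult_diff_right algebra_simps)
      moreover have "smult (e * lead_coeff E) Q = (A + smult e (monom (lead_coeff Q) k)) * E + R"
        using IH(6) by (simp add: Q'_def smult_diff_right algebra_simps)
      moreover have "(e\<^sub>0 * l, e * lead_coeff E) \<in> \<rho>" using rel_mult IH lE by blast
      moreover have "poly_rel (A\<^sub>0 + smult e\<^sub>0 (monom c k)) (A + smult e (monom (lead_coeff Q) k))"
        using IH by (intro poly_rel_add poly_rel_smult poly_rel_monom cQ)
      ultimately show ?thesis using IH assms(2)
        by (metis leading_coeff_0_iff mult_eq_0_iff)
    qed
  qed
  then show thesis using that by blast
qed

text \<open>The hypothesis says that evaluation at \<open>a\<close> modulo \<open>Z\<close> and
  evaluation at \<open>z\<close> have the same kernel, so sending \<open>a\<close> to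
  \<open>z\<close> extends the embedding to the ring generated by \<open>a\<close>.\<close>

lemma adjoin:
  assumes "\<And>P Q. poly_rel P Q \<Longrightarrow> poly P a \<in> Z \<longleftrightarrow> poly Q z = 0"
  shows "residue_embedding {(poly P a, poly Q z) | P Q. poly_rel P Q} Z"
proof
  let ?\<rho> = "{(poly P a, poly Q z) | P Q. poly_rel P Q}"
  show "(rat_incl q, rat_incl q) \<in> ?\<rho>" for q
    using poly_rel_const[OF rel_rat[of q]] by (metis (mono_tags, lifting) mem_Collect_eq poly_const_conv)
  show "(a + c, b + d) \<in> ?\<rho>" if "(a, b) \<in> ?\<rho>" "(c, d) \<in> ?\<rho>" for a b c d
    using that poly_rel_add by clarsimp (metis poly_add)
  show "(a * c, b * d) \<in> ?\<rho>" if "(a, b) \<in> ?\<rho>" "(c, d) \<in> ?\<rho>" for a b c d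
    using that poly_rel_mult by clarsimp (metis poly_mult)
qed (use assms prime in auto)

text \<open>If \<open>a\<close> is transcendental modulo \<open>Z\<close>, any complex number
  transcendental over the image will do. If it is algebraic, a root of the image of an equation of
  minimal degree for \<open>a\<close> will do.\<close>

lemma extension_value:
  assumes "countable \<rho>"
  obtains z where "\<And>P Q. poly_rel P Q \<Longrightarrow> poly P a \<in> Z \<longleftrightarrow> poly Q z = 0"
proof (cases "\<exists>P Q. poly_rel P Q \<and> Q \<noteq> 0 \<and> poly P a \<in> Z")
  case False
  \<comment> \<open>\<open>B\<close> collects the complex numbers algebraic over the image; it is
    countable, so some value lies outside it.\<close>
  define B where "B = (\<Union>(P, Q) \<in> {(P, Q). poly_rel P Q \<and> Q \<noteq> 0}. {z. poly Q z = 0})"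
  have "countable {(P, Q). poly_rel P Q \<and> Q \<noteq> 0}"
    by (rule countable_subset[OF _ countable_poly_rel[OF assms]]) auto
  then have "countable B"
    unfolding B_def by (rule countable_UN) (auto simp: poly_roots_finite countable_finite)
  then obtain z where "z \<notin> B" using uncountable_UNIV_complex by (metis UNIV_eq_I)
  then show thesis using that[of z] False poly_rel_vanish by (fastforce simp: B_def)
next
  case True
  define alg where "alg = (\<lambda>(P, Q). poly_rel P Q \<and> Q \<noteq> 0 \<and> poly P a \<in> Z)"
  obtain F\<^sub>0 F where F: "poly_rel F\<^sub>0 F" "F \<noteq> 0" "poly F\<^sub>0 a \<in> Z"
    and minF: "\<And>P Q. poly_rel P Q \<Longrightarrow> Q \<noteq> 0 \<Longrightarrow> poly P a \<in> Z \<Longrightarrow> degree F \<le> degree Q"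
    using True ex_has_least_nat[of alg _ "\<lambda>(P, Q). degree Q"] by (fastforce simp: alg_def)
  \<comment> \<open>A nonzero constant image would put the constant coefficient of
    \<open>F\<^sub>0\<close> into \<open>Z\<close>, as its other coefficients are in
    \<open>Z\<close> already.\<close>
  have "degree F \<noteq> 0"
  proof
    assume "degree F = 0"
    then obtain c where c: "F = [:c:]" by (rule degree_eq_zeroE)
    have c\<^sub>0: "(coeff F\<^sub>0 0, c) \<in> \<rho>" using F(1) c unfolding poly_rel_def by (metis coeff_pCons_0)
    have "poly_rel (F\<^sub>0 - [:coeff F\<^sub>0 0:]) (F - [:c:])"
      by (intro poly_rel_diff F poly_rel_const c\<^sub>0)
    then have "poly F\<^sub>0 a - coeff F\<^sub>0 0 \<in> Z" using poly_rel_vanish c by fastforce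
    then have "coeff F\<^sub>0 0 \<in> Z"
      using prime_ideal_add_iff[OF prime, of "poly F\<^sub>0 a - coeff F\<^sub>0 0" "coeff F\<^sub>0 0"] F(3) by simp
    then show False using rel_zero_iff[OF c\<^sub>0] F(2) c by simp
  qed
  then obtain z where z: "poly F z = 0"
    using fundamental_theorem_of_algebra[of F] constant_degree[of F] by auto
  \<comment> \<open>\<open>F\<close> is minimal for vanishing at \<open>a\<close> modulo
    \<open>Z\<close>, \<open>E\<close> for vanishing at \<open>z\<close>. Pseudo-division by one or
    the other gives the two directions of the equivalence, once \<open>E\<^sub>0\<close> is known to
    vanish at \<open>a\<close> modulo \<open>Z\<close>.\<close>
  define rt where "rt = (\<lambda>(P, Q). poly_rel P Q \<and> Q \<noteq> 0 \<and> poly Q z = 0)"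
  obtain E\<^sub>0 E where E: "poly_rel E\<^sub>0 E" "E \<noteq> 0" "poly E z = 0"
    and minE: "\<And>P Q. poly_rel P Q \<Longrightarrow> Q \<noteq> 0 \<Longrightarrow> poly Q z = 0 \<Longrightarrow> degree E \<le> degree Q"
    using F z ex_has_least_nat[of rt "(F\<^sub>0, F)" "\<lambda>(P, Q). degree Q"] by (fastforce simp: rt_def)
  have dE: "degree E \<noteq> 0"
    using E by (metis degree_eq_zeroE mult_zero_right pCons_0_0 poly_const_conv)
  note mem = prime_ideal_mult_iff[OF prime] prime_ideal_add_iff[OF prime]
  \<comment> \<open>Otherwise \<open>E\<close> divides \<open>F\<close> up to a scalar, and the
    lifted quotient vanishes at \<open>a\<close> modulo \<open>Z\<close> although its image has
    smaller degree than \<open>F\<close>.\<close>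
  have E0: "poly E\<^sub>0 a \<in> Z"
  proof (rule ccontr)
    assume nE: "poly E\<^sub>0 a \<notin> Z"
    obtain e\<^sub>0 e A\<^sub>0 A R\<^sub>0 R where d: "(e\<^sub>0, e) \<in> \<rho>" "e \<noteq> 0" "poly_rel A\<^sub>0 A" "poly_rel R\<^sub>0 R"
      "smult e\<^sub>0 F\<^sub>0 = A\<^sub>0 * E\<^sub>0 + R\<^sub>0" "smult e F = A * E + R" "R = 0 \<or> degree R < degree E"
      using pseudo_division[OF E(1,2) F(1)] .
    have "poly R z = 0" using arg_cong[OF d(6), of "\<lambda>P. poly P z"] z E(3) by simp
    then have R: "R = 0" using minE[OF d(4)] d(7) by fastforce
    have "e\<^sub>0 * poly F\<^sub>0 a = poly A\<^sub>0 a * poly E\<^sub>0 a + poly R\<^sub>0 a"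
      using arg_cong[OF d(5), of "\<lambda>P. poly P a"] by simp
    then have "poly A\<^sub>0 a \<in> Z" using F(3) poly_rel_vanish[of R\<^sub>0] d(4) R nE mem by metis
    moreover have AE: "smult e F = A * E" using d(6) R by simp
    then have A: "A \<noteq> 0" using F(2) d(2) by auto
    moreover have "degree F = degree A + degree E"
      using AE A E(2) d(2) by (metis degree_mult_eq degree_smult_eq)
    ultimately show False using minF[OF d(3)] dE by simp
  qed
  show thesis
  proof (rule that[of z])
    fix P Q assume PQ: "poly_rel P Q"
    show "poly P a \<in> Z \<longleftrightarrow> poly Q z = 0"
    proof
      assume h: "poly P a \<in> Z"
      obtain e\<^sub>0 e A\<^sub>0 A R\<^sub>0 R where d: "(e\<^sub>0, e) \<in> \<rho>" "e \<noteq> 0" "poly_rel A\<^sub>0 A" "poly_rel R\<^sub>0 R"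
        "smult e\<^sub>0 P = A\<^sub>0 * F\<^sub>0 + R\<^sub>0" "smult e Q = A * F + R" "R = 0 \<or> degree R < degree F"
        using pseudo_division[OF F(1,2) PQ] .
      have "e\<^sub>0 * poly P a = poly R\<^sub>0 a + poly A\<^sub>0 a * poly F\<^sub>0 a"
        using arg_cong[OF d(5), of "\<lambda>P. poly P a"] by (simp add: add.commute)
      then have "poly R\<^sub>0 a \<in> Z" using h F(3) mem by metis
      then have "R = 0" using minF[OF d(4)] d(7) by fastforce
      then show "poly Q z = 0" using arg_cong[OF d(6), of "\<lambda>P. poly P z"] z d(2) by simp
    next
      assume h: "poly Q z = 0"
      obtain e\<^sub>0 e A\<^sub>0 A R\<^sub>0 R where d: "(e\<^sub>0, e) \<in> \<rho>" "e \<noteq> 0" "poly_rel A\<^sub>0 A" "poly_rel R\<^sub>0 R"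
        "smult e\<^sub>0 P = A\<^sub>0 * E\<^sub>0 + R\<^sub>0" "smult e Q = A * E + R" "R = 0 \<or> degree R < degree E"
        using pseudo_division[OF E(1,2) PQ] .
      have "poly R z = 0" using arg_cong[OF d(6), of "\<lambda>P. poly P z"] h E(3) by simp
      then have R: "R = 0" using minE[OF d(4)] d(7) by fastforce
      have "e\<^sub>0 * poly P a = poly A\<^sub>0 a * poly E\<^sub>0 a + poly R\<^sub>0 a"
        using arg_cong[OF d(5), of "\<lambda>P. poly P a"] by simp
      then have "e\<^sub>0 * poly P a \<in> Z" using E0 poly_rel_vanish[of R\<^sub>0] d(4) R mem by metis
      then show "poly P a \<in> Z" using rel_zero_iff[OF d(1)] d(2) mem by blast
    qed
  qed
qed

lemma extend:
  assumes "countable \<rho>"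
  obtains \<rho>' where "residue_embedding \<rho>' Z" "countable \<rho>'" "\<rho> \<subseteq> \<rho>'" "a \<in> fst ` \<rho>'"
proof -
  obtain z where z: "\<And>P Q. poly_rel P Q \<Longrightarrow> poly P a \<in> Z \<longleftrightarrow> poly Q z = 0"
    using extension_value[OF assms] by blast
  let ?\<rho> = "{(poly P a, poly Q z) | P Q. poly_rel P Q}"
  have "?\<rho> = (\<lambda>(P, Q). (poly P a, poly Q z)) ` {(P, Q). poly_rel P Q}" by auto
  then have "countable ?\<rho>" by (simp only:) (intro countable_image countable_poly_rel assms)
  moreover have "\<rho> \<subseteq> ?\<rho>"
  proof clarify
    fix b c assume "(b, c) \<in> \<rho>"
    then show "\<exists>P Q. (b, c) = (poly P a, poly Q z) \<and> poly_rel P Q"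
      by (intro exI[of _ "[:b:]"] exI[of _ "[:c:]"]) (simp add: poly_rel_const)
  qed
  moreover have "(a, z) \<in> ?\<rho>"
    by (rule CollectI, intro exI[of _ "[:0, 1:]"]) (simp add: poly_rel_X)
  then have "a \<in> fst ` ?\<rho>" by force
  ultimately show thesis using adjoin[OF z] that by blast
qed

end

text \<open>A nonzero rational is a unit of the algebra and so lies outside every prime
  ideal.\<close>

lemma residue_embedding_rat:
  assumes Z: "prime_ideal (Z :: 'a::rat_algebra set)"
  shows "residue_embedding (range (\<lambda>q. (rat_incl q, rat_incl q))) Z"
proof
  have "rat_incl q \<in> Z \<longleftrightarrow> q = 0" for q
  proof (cases "q = 0")
    case True
    then show ?thesis using Z by (simp add: prime_ideal_def)
  next
    case False
    then have "rat_incl q * rat_incl (inverse q) = (1 :: 'a)"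
      by (simp flip: rat_incl_mult add: rat_incl_1)
    then show ?thesis using False Z prime_ideal_mult_iff[OF Z, of "rat_incl q" "rat_incl (inverse q)"]
      by (auto simp: prime_ideal_def)
  qed
  note * = this
  show "a \<in> Z \<longleftrightarrow> z = 0" if "(a, z) \<in> range (\<lambda>q. (rat_incl q, rat_incl q))" for a and z :: complex
  proof -
    from that obtain q where "a = rat_incl q" "z = of_rat q" by (auto simp: rat_incl_complex_def)
    then show ?thesis by (simp add: *)
  qed
qed (use Z in \<open>auto simp flip: rat_incl_add rat_incl_mult\<close>)

text \<open>The embeddings in the induction are kept countable, so that another element can always
  be adjoined. Finite sets suffice, because only the entries of a few matrices have to be
  transported.\<close>

theorem residue_embedding_exists:
  assumes "prime_ideal (Z :: 'a::rat_algebra set)" "finite A"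
  obtains \<rho> where "residue_embedding \<rho> Z" "A \<subseteq> fst ` \<rho>"
proof -
  have "\<exists>\<rho>. residue_embedding \<rho> Z \<and> countable \<rho> \<and> A \<subseteq> fst ` \<rho>"
    using assms(2)
  proof induction
    case empty
    have "countable (range (\<lambda>q. (rat_incl q, rat_incl q) :: 'a \<times> complex))" by simp
    then show ?case using residue_embedding_rat[OF assms(1)] by blast
  next
    case (insert a A)
    then obtain \<rho> where \<rho>: "residue_embedding \<rho> Z" "countable \<rho>" "A \<subseteq> fst ` \<rho>" by blast
    obtain \<rho>' where \<rho>': "residue_embedding \<rho>' Z" "countable \<rho>'" "\<rho> \<subseteq> \<rho>'" "a \<in> fst ` \<rho>'"
      using residue_embedding.extend[OF \<rho>(1,2)] .
    then have "insert a A \<subseteq> fst ` \<rho>'" using \<rho>(3) image_mono[OF \<rho>'(3), of fst] by simp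
    then show ?case using \<rho>' by blast
  qed
  then show thesis using that by blast
qed

section \<open>Points over separated algebras\<close>

lemma prime_ideal_zero: "prime_ideal {0 :: 'a::idom}"
  by (auto simp: prime_ideal_def)

text \<open>The finite adeles have zero divisors and do not embed into a field. When the prime
  ideals intersect in 0, an identity may still be checked in each residue domain separately.\<close>

class separated_algebra = rat_algebra +
  assumes prime_separation: "x \<noteq> 0 \<Longrightarrow> \<exists>Z. prime_ideal Z \<and> x \<notin> Z"

instance rat :: separated_algebra
  by standard (use prime_ideal_zero in blast)

instance real :: separated_algebra
  by standard (use prime_ideal_zero in blast)

section \<open>Absolute values of finite adeles\<close>

lemma padic_abs_diff_le:
  assumes "prime p" shows "\<bar>padic_abs p x - padic_abs p y\<bar> \<le> padic_abs p (x - y)"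
  using padic_abs_triangle[OF assms, of "x - y" y] padic_abs_triangle[OF assms, of "y - x" x]
    padic_abs_minus[of p "x - y"] by simp

text \<open>Carrying a representative along reduces properties of \<open>fadele_abs\<close> to
  limits of rational absolute values.\<close>

definition represents :: "(nat \<Rightarrow> nat \<Rightarrow> rat) \<Rightarrow> fadele \<Rightarrow> bool" where
  "represents X x \<longleftrightarrow> fadele_rep X \<and> x = abs_fadele X"

lemma represents_ex: obtains X where "represents X x"
  using Quotient_fadele unfolding represents_def Quotient_def by (metis fadele_rel_repD)

lemma represents_abs:
  assumes p: "prime p" and "represents X x"
  shows "(\<lambda>n. padic_abs p (X p n)) \<longlonglongrightarrow> fadele_abs p x"
proof -
  have X: "fadele_rep X" "x = abs_fadele X" using assms(2) by (auto simp: represents_def)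
  have "Cauchy (\<lambda>n. padic_abs p (X p n))"
  proof (rule CauchyI)
    fix e :: real assume "e > 0"
    then obtain N where "\<forall>m\<ge>N. \<forall>n\<ge>N. padic_abs p (X p m - X p n) < e"
      using X(1) p unfolding fadele_rep_def padic_cauchy_def by blast
    then show "\<exists>M. \<forall>m\<ge>M. \<forall>n\<ge>M. norm (padic_abs p (X p m) - padic_abs p (X p n)) < e"
      using padic_abs_diff_le[OF p] by (metis order_le_less_trans real_norm_def)
  qed
  then have "convergent (\<lambda>n. padic_abs p (X p n))" by (simp add: Cauchy_convergent_iff)
  then show ?thesis
    using X p by (simp add: fadele_abs.abs_eq fadele_rel_refl convergent_LIMSEQ_iff)
qed

lemma represents_add:
  "represents X x \<Longrightarrow> represents Y y \<Longrightarrow> represents (\<lambda>p n. X p n + Y p n) (x + y)"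
  by (simp add: represents_def fadele_rep_add plus_fadele.abs_eq fadele_rel_refl)

lemma represents_mult:
  "represents X x \<Longrightarrow> represents Y y \<Longrightarrow> represents (\<lambda>p n. X p n * Y p n) (x * y)"
  by (simp add: represents_def fadele_rep_mult times_fadele.abs_eq fadele_rel_refl)

lemma represents_rat: "represents (\<lambda>_ _. q) (rat_incl q)"
  by (simp add: represents_def fadele_rep_const rat_incl_fadele.abs_eq)

lemma fadele_abs_rat: "prime p \<Longrightarrow> fadele_abs p (rat_incl q) = padic_abs p q"
  using LIMSEQ_unique[OF tendsto_const represents_abs[OF _ represents_rat]] by simp

lemma fadele_abs_0 [simp]: "prime p \<Longrightarrow> fadele_abs p 0 = 0"
  using fadele_abs_rat[of p 0] by simp

lemma fadele_abs_1 [simp]: "prime p \<Longrightarrow> fadele_abs p 1 = 1"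
  using fadele_abs_rat[of p 1] by (simp add: rat_incl_1)

lemma fadele_abs_nonneg: "prime p \<Longrightarrow> 0 \<le> fadele_abs p x"
  using represents_ex[of x] represents_abs[of p] by (metis LIMSEQ_le_const padic_abs_nonneg)

lemma fadele_abs_mult:
  assumes p: "prime p" shows "fadele_abs p (x * y) = fadele_abs p x * fadele_abs p y"
proof -
  obtain X Y where *: "represents X x" "represents Y y" by (metis represents_ex)
  show ?thesis
    using LIMSEQ_unique[OF represents_abs[OF p represents_mult[OF *]]]
      tendsto_mult[OF represents_abs[OF p *(1)] represents_abs[OF p *(2)]]
    by (simp add: padic_abs_mult[OF p])
qed

lemma fadele_abs_ultra:
  assumes p: "prime p" shows "fadele_abs p (x + y) \<le> max (fadele_abs p x) (fadele_abs p y)"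
proof -
  obtain X Y where *: "represents X x" "represents Y y" by (metis represents_ex)
  show ?thesis
    by (rule LIMSEQ_le[OF represents_abs[OF p represents_add[OF *]]
          tendsto_max[OF represents_abs[OF p *(1)] represents_abs[OF p *(2)]]])
       (use padic_abs_ultra[OF p] in blast)
qed

lemma fadele_eq_0I:
  assumes "\<And>p. prime p \<Longrightarrow> fadele_abs p x = 0" shows "x = 0"
proof -
  obtain X where X: "represents X x" by (rule represents_ex)
  have "fadele_rel X (\<lambda>_ _. 0)"
    using represents_abs[OF _ X] assms X by (auto simp: fadele_rel_def represents_def fadele_rep_const)
  then have "abs_fadele X = abs_fadele (\<lambda>_ _. 0)" by (rule Quotient_rel_abs[OF Quotient_fadele])
  then show ?thesis using X by (simp add: represents_def zero_fadele_def)
qed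

text \<open>This is the kernel of the projection to the p-adic numbers; multiplicativity of the
  absolute value makes it prime. By \<open>fadele_eq_0I\<close> these ideals intersect in 0.\<close>

lemma prime_ideal_fadele:
  assumes p: "prime p" shows "prime_ideal {x. fadele_abs p x = 0}"
  unfolding prime_ideal_def
proof (intro conjI ballI allI impI)
  show "a + b \<in> {x. fadele_abs p x = 0}"
    if "a \<in> {x. fadele_abs p x = 0}" "b \<in> {x. fadele_abs p x = 0}" for a b
    using that fadele_abs_ultra[OF p, of a b] fadele_abs_nonneg[OF p, of "a + b"] by simp
qed (use p in \<open>auto simp: fadele_abs_mult\<close>)

instance fadele :: separated_algebra
proof
  fix x :: fadele assume "x \<noteq> 0"
  then obtain p where "prime p" "fadele_abs p x \<noteq> 0" using fadele_eq_0I by blast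
  then show "\<exists>Z. prime_ideal Z \<and> x \<notin> Z" using prime_ideal_fadele by blast
qed

section \<open>Inverses of matrices over semirings\<close>

lemma matrix_inv_right: "invertible A \<Longrightarrow> A ** matrix_inv A = mat 1"
  unfolding invertible_def matrix_inv_def by (metis (mono_tags, lifting) someI_ex)

lemma matrix_inv_left: "invertible A \<Longrightarrow> matrix_inv A ** A = mat 1"
  unfolding invertible_def matrix_inv_def by (metis (mono_tags, lifting) someI_ex)

lemma matrix_inv_eqI:
  fixes A :: "'a::semiring_1 ^ 'n ^ 'n"
  assumes "A ** B = mat 1" "B ** A = mat 1" shows "matrix_inv A = B"
proof -
  have "invertible A" using assms by (auto simp: invertible_def)
  then have "matrix_inv A ** (A ** B) = B" by (simp add: matrix_mul_assoc matrix_inv_left)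
  then show ?thesis using assms by simp
qed

lemma invertible_matrix_inv: "invertible A \<Longrightarrow> invertible (matrix_inv A)"
  using matrix_inv_left matrix_inv_right unfolding invertible_def by blast

lemma matrix_inv_inv: "invertible (A :: 'a::semiring_1 ^ 'n ^ 'n) \<Longrightarrow> matrix_inv (matrix_inv A) = A"
  by (intro matrix_inv_eqI matrix_inv_left matrix_inv_right)

lemma invertible_mat_1: "invertible (mat 1 :: 'a::semiring_1 ^ 'n ^ 'n)"
  by (auto simp: invertible_def)

lemma matrix_inv_mat_1 [simp]: "matrix_inv (mat 1 :: 'a::semiring_1 ^ 'n ^ 'n) = mat 1"
  by (intro matrix_inv_eqI) auto

lemma invertible_times:
  fixes A B :: "'a::semiring_1 ^ 'n ^ 'n"
  assumes "invertible A" "invertible B" shows "invertible (A ** B)"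
    and "matrix_inv (A ** B) = matrix_inv B ** matrix_inv A"
proof -
  have "A ** B ** (matrix_inv B ** matrix_inv A) = A ** (B ** matrix_inv B) ** matrix_inv A"
    "matrix_inv B ** matrix_inv A ** (A ** B) = matrix_inv B ** (matrix_inv A ** A) ** B"
    by (simp_all add: matrix_mul_assoc)
  then have *: "A ** B ** (matrix_inv B ** matrix_inv A) = mat 1"
    "matrix_inv B ** matrix_inv A ** (A ** B) = mat 1"
    using assms by (simp_all add: matrix_inv_left matrix_inv_right)
  then show "invertible (A ** B)" unfolding invertible_def by blast
  show "matrix_inv (A ** B) = matrix_inv B ** matrix_inv A" using * by (rule matrix_inv_eqI)
qed

section \<open>Matrices with related entries\<close>

definition mat_rel :: "('a \<times> 'b) set \<Rightarrow> 'a ^ 'n ^ 'n \<Rightarrow> 'b ^ 'n ^ 'n \<Rightarrow> bool" where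
  "mat_rel \<rho> g h \<longleftrightarrow> (\<forall>i j. (g $ i $ j, h $ i $ j) \<in> \<rho>)"

text \<open>The inverses are included because \<open>gl_coord\<close> evaluates the determinant of
  the inverse, and the domain of the relation need not be closed under inversion.\<close>

definition gl_rel ::
    "('a \<times> 'b) set \<Rightarrow> 'a::comm_ring_1 ^ 'n ^ 'n \<Rightarrow> 'b::comm_ring_1 ^ 'n ^ 'n \<Rightarrow> bool" where
  "gl_rel \<rho> g h \<longleftrightarrow> invertible g \<and> invertible h \<and> mat_rel \<rho> g h \<and>
     mat_rel \<rho> (matrix_inv g) (matrix_inv h)"

context ring_relation
begin

lemma mat_rel_mult: "mat_rel \<rho> g h \<Longrightarrow> mat_rel \<rho> g' h' \<Longrightarrow> mat_rel \<rho> (g ** g') (h ** h')"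
  by (auto simp: mat_rel_def matrix_matrix_mult_def intro!: rel_sum rel_mult)

lemma mat_rel_1: "mat_rel \<rho> (mat 1) (mat 1)"
  by (simp add: mat_rel_def mat_def rel_0 rel_1)

lemma rel_det: 
  assumes "mat_rel \<rho> g h" shows "(det g, det h) \<in> \<rho>"
proof -
  have "(of_int (sign s), of_int (sign s)) \<in> \<rho>" for s :: "'n \<Rightarrow> 'n"
    by (cases "evenperm s") (auto simp: sign_def rel_1 rel_uminus)
  then show ?thesis using assms
    by (auto simp: det_def mat_rel_def intro!: rel_sum rel_mult rel_prod)
qed

lemma gl_rel_1: "gl_rel \<rho> (mat 1) (mat 1)"
  by (simp add: gl_rel_def mat_rel_1 invertible_mat_1)

lemma gl_rel_mult: "gl_rel \<rho> g h \<Longrightarrow> gl_rel \<rho> g' h' \<Longrightarrow> gl_rel \<rho> (g ** g') (h ** h')"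
  by (simp add: gl_rel_def invertible_times mat_rel_mult)

lemma gl_rel_inv: "gl_rel \<rho> g h \<Longrightarrow> gl_rel \<rho> (matrix_inv g) (matrix_inv h)"
  by (simp add: gl_rel_def invertible_matrix_inv matrix_inv_inv)

lemma rel_qeval:
  assumes "gl_rel \<rho> g h" shows "(qeval p g, qeval p h) \<in> \<rho>"
proof -
  have "(gl_coord g v, gl_coord h v) \<in> \<rho>" for v
    using assms rel_det unfolding gl_rel_def gl_coord_def mat_rel_def
    by (auto split: option.split)
  then show ?thesis unfolding gl_eval_def
    by (intro rel_sum rel_mult rel_prod rel_power rel_rat)
qed

end

text \<open>With the graph of an actual homomorphism, \<open>rel_qeval\<close> becomes compatibility
  of evaluation with extension of scalars.\<close>

lemma ring_relation_rat_incl: "ring_relation (range (\<lambda>q. (q, rat_incl q)))"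
  by standard (auto simp: rat_incl_rat_def simp flip: rat_incl_add rat_incl_mult)

lemma gl_rel_rat_incl:
  fixes g :: "rat ^ 'n ^ 'n"
  assumes "invertible g"
  shows "gl_rel (range (\<lambda>q. (q, rat_incl q :: 'a::rat_algebra))) g (map_matrix rat_incl g)"
    and "matrix_inv (map_matrix rat_incl g) = (map_matrix rat_incl (matrix_inv g) :: 'a ^ 'n ^ 'n)"
proof -
  let ?\<rho> = "range (\<lambda>q. (q, rat_incl q :: 'a))"
  interpret ring_relation ?\<rho> by (rule ring_relation_rat_incl)
  have eq: "h = map_matrix rat_incl g" if "mat_rel ?\<rho> g h" for g :: "rat ^ 'n ^ 'n" and h
    using that by (auto simp: mat_rel_def map_matrix_def vec_eq_iff)
  have rel: "mat_rel ?\<rho> g (map_matrix rat_incl g)" for g :: "rat ^ 'n ^ 'n"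
    by (simp add: mat_rel_def map_matrix_def)
  have 1: "map_matrix rat_incl g ** map_matrix rat_incl h = (mat 1 :: 'a ^ 'n ^ 'n)"
    if "g ** h = mat 1" for g h :: "rat ^ 'n ^ 'n"
    using eq[OF mat_rel_mult[OF rel[of g] rel[of h]]] eq[OF mat_rel_1] that by simp
  note 2 = 1[OF matrix_inv_right[OF assms]] 1[OF matrix_inv_left[OF assms]]
  show inv: "matrix_inv (map_matrix rat_incl g) = (map_matrix rat_incl (matrix_inv g) :: 'a ^ 'n ^ 'n)"
    by (rule matrix_inv_eqI[OF 2])
  show "gl_rel ?\<rho> g (map_matrix rat_incl g)"
    unfolding gl_rel_def inv using assms 2 rel by (auto simp: invertible_def)
qed

lemma qeval_rat_incl:
  fixes g :: "rat ^ 'n ^ 'n"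
  assumes "invertible g"
  shows "qeval p (map_matrix rat_incl g :: 'a::rat_algebra ^ 'n ^ 'n) = rat_incl (qeval p g)"
  using ring_relation.rel_qeval[OF ring_relation_rat_incl gl_rel_rat_incl(1)[OF assms], of p] by auto

lemma vanishing_ideal_mono: "H \<subseteq> H' \<Longrightarrow> vanishing_ideal H' \<subseteq> vanishing_ideal H"
  by (auto simp: vanishing_ideal_def)

lemma pts_mono: "H \<subseteq> H' \<Longrightarrow> pts H \<subseteq> pts H'"
  using vanishing_ideal_mono[of H H'] unfolding pts_def by blast

lemma pts_rat_incl: "g \<in> pts H \<Longrightarrow> map_matrix rat_incl g \<in> pts H"
  using gl_rel_rat_incl(1)[of g] by (auto simp: pts_def qeval_rat_incl gl_rel_def)

section \<open>Specializing matrices to complex matrices\<close>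

context residue_embedding
begin

lemma mat_lift:
  assumes "\<And>i j. g $ i $ j \<in> fst ` \<rho>" obtains h where "mat_rel \<rho> g h"
proof -
  have "\<forall>i j. \<exists>z. (g $ i $ j, z) \<in> \<rho>" using assms by force
  then obtain z where "\<forall>i j. (g $ i $ j, z i j) \<in> \<rho>" by metis
  then show thesis by (intro that[of "\<chi> i j. z i j"]) (simp add: mat_rel_def)
qed

text \<open>The difference of two complex partners of one element is related to 0, which lies in
  \<open>Z\<close>, and so vanishes.\<close>

lemma mat_rel_unique: "mat_rel \<rho> g h \<Longrightarrow> mat_rel \<rho> g h' \<Longrightarrow> h = h'"
proof -
  assume "mat_rel \<rho> g h" "mat_rel \<rho> g h'"
  then have "(0, h $ i $ j - h' $ i $ j) \<in> \<rho>" for i j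
    using rel_diff unfolding mat_rel_def by (metis diff_self)
  moreover have "0 \<in> Z" using prime by (simp add: prime_ideal_def)
  ultimately have "h $ i $ j - h' $ i $ j = 0" for i j using rel_zero_iff by blast
  then show "h = h'" by (simp add: vec_eq_iff)
qed

text \<open>The matrix and its inverse are lifted independently; the products of the lifts are
  related to the identity and so equal it by uniqueness.\<close>

lemma gl_lift:
  assumes "invertible g" "\<And>i j. g $ i $ j \<in> fst ` \<rho>" "\<And>i j. matrix_inv g $ i $ j \<in> fst ` \<rho>"
  obtains h where "gl_rel \<rho> g h"
proof -
  obtain h h' where h: "mat_rel \<rho> g h" "mat_rel \<rho> (matrix_inv g) h'"
    using mat_lift assms(2,3) by metis
  have "h ** h' = mat 1" "h' ** h = mat 1"
    using mat_rel_mult[OF h(1) h(2)] mat_rel_mult[OF h(2) h(1)] mat_rel_unique[OF _ mat_rel_1] assms(1)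
    by (auto simp: matrix_inv_left matrix_inv_right)
  then have "gl_rel \<rho> g h"
    unfolding gl_rel_def using h assms(1) matrix_inv_eqI[of h h'] by (auto simp: invertible_def)
  then show thesis by (rule that)
qed

text \<open>The equations pass to the complex side since 0 lies in \<open>Z\<close>. In the other
  direction they would hold only modulo \<open>Z\<close>.\<close>

lemma gl_rel_pts: "gl_rel \<rho> g h \<Longrightarrow> g \<in> pts H \<Longrightarrow> h \<in> pts H"
  using rel_qeval rel_zero_iff prime unfolding pts_def gl_rel_def prime_ideal_def mem_Collect_eq by metis

end

text \<open>Carries identities from the group of complex points over to all points.\<close>

lemma pts_specialize:
  assumes "prime_ideal (Z :: 'a::rat_algebra set)" "g \<in> pts H" "h \<in> pts H"
  obtains \<rho> g' h' where "residue_embedding \<rho> Z" "gl_rel \<rho> g g'" "gl_rel \<rho> h h'"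
    "g' \<in> pts H" "h' \<in> pts H"
proof -
  define A where "A = (\<Union>i j. {g $ i $ j, matrix_inv g $ i $ j, h $ i $ j, matrix_inv h $ i $ j})"
  have "finite A" unfolding A_def by auto
  then obtain \<rho> where \<rho>: "residue_embedding \<rho> Z" "A \<subseteq> fst ` \<rho>"
    using residue_embedding_exists[OF assms(1)] by blast
  interpret residue_embedding \<rho> Z by (rule \<rho>)
  have A: "g $ i $ j \<in> fst ` \<rho>" "matrix_inv g $ i $ j \<in> fst ` \<rho>"
    "h $ i $ j \<in> fst ` \<rho>" "matrix_inv h $ i $ j \<in> fst ` \<rho>" for i j
    by (rule subsetD[OF \<rho>(2)], force simp: A_def)+
  have "invertible g" "invertible h" using assms by (auto simp: pts_def)
  then obtain g' h' where "gl_rel \<rho> g g'" "gl_rel \<rho> h h'"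
    using gl_lift[of g] gl_lift[of h] A by metis
  then show thesis using that \<rho>(1) gl_rel_pts assms by blast
qed

text \<open>A nonzero \<open>x\<close> is avoided by some prime ideal, but specialization modulo
  that ideal would place \<open>x\<close> in it.\<close>

lemma pts_identity:
  fixes g h :: "'a::separated_algebra ^ 'n ^ 'n"
  assumes "g \<in> pts H" "h \<in> pts H"
    and "\<And>\<rho> Z g' h'. residue_embedding \<rho> Z \<Longrightarrow> gl_rel \<rho> g g' \<Longrightarrow> gl_rel \<rho> h h' \<Longrightarrow>
      g' \<in> pts H \<Longrightarrow> h' \<in> pts H \<Longrightarrow> (x, 0) \<in> \<rho>"
  shows "x = 0"
proof (rule ccontr)
  assume "x \<noteq> 0"
  then obtain Z where Z: "prime_ideal Z" "x \<notin> Z" using prime_separation by blast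
  obtain \<rho> g' h' where *: "residue_embedding \<rho> Z" "gl_rel \<rho> g g'" "gl_rel \<rho> h h'" "g' \<in> pts H" "h' \<in> pts H"
    using pts_specialize[OF Z(1) assms(1,2)] .
  then show False using assms(3)[OF *] residue_embedding.rel_zero_iff[OF *(1)] Z(2) by blast
qed

section \<open>The group of points and its characters\<close>

lemma inv_gl:
  fixes g :: "'a::comm_ring_1 ^ 'n ^ 'n"
  assumes "invertible g" shows "inv\<^bsub>gl\<^esub> g = matrix_inv g"
  unfolding m_inv_def
  by (rule the_equality)
     (use assms invertible_matrix_inv matrix_inv_eqI in
       \<open>auto simp: gl_def matrix_inv_left matrix_inv_right\<close>)

lemma q_group_closed:
  fixes g h :: "complex ^ 'n ^ 'n"
  assumes "q_group H"
  shows "(mat 1 :: complex ^ 'n ^ 'n) \<in> pts H" "g \<in> pts H \<Longrightarrow> h \<in> pts H \<Longrightarrow> g ** h \<in> pts H"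
    "g \<in> pts H \<Longrightarrow> matrix_inv g \<in> pts H"
proof -
  have H: "pts H = H" "subgroup H gl" using assms by (auto simp: q_group_def)
  show "(mat 1 :: complex ^ 'n ^ 'n) \<in> pts H" using subgroup.one_closed[OF H(2)] H(1) by (simp add: gl_def)
  show "g ** h \<in> pts H" if "g \<in> pts H" "h \<in> pts H"
    using subgroup.m_closed[OF H(2)] that H(1) by (simp add: gl_def)
  show "matrix_inv g \<in> pts H" if g: "g \<in> pts H"
  proof -
    have i: "invertible g" using g by (simp add: pts_def)
    then show ?thesis using subgroup.m_inv_closed[OF H(2), of g] g H(1) inv_gl by metis
  qed
qed

text \<open>The value of an equation at the identity is a rational number, which can be compared
  with its complex value and then included in the algebra.\<close>

lemma pts_one:
  assumes H: "q_group H" shows "(mat 1 :: 'a::separated_algebra ^ 'n ^ 'n) \<in> pts H"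
proof -
  have "qeval p (mat 1 :: 'a ^ 'n ^ 'n) = 0" if p: "p \<in> vanishing_ideal H" for p
  proof -
    have "qeval p (mat 1 :: rat ^ 'n ^ 'n) = 0"
    proof -
      interpret residue_embedding "range (\<lambda>q. (rat_incl q, rat_incl q))" "{0 :: rat}"
        by (rule residue_embedding_rat[OF prime_ideal_zero])
      have "qeval p (mat 1 :: complex ^ 'n ^ 'n) = 0"
        using q_group_closed(1)[OF H] p by (simp add: pts_def)
      then show ?thesis using rel_zero_iff[OF rel_qeval[OF gl_rel_1, of p]] by simp
    qed
    moreover have "map_matrix rat_incl (mat 1) = (mat 1 :: 'a ^ 'n ^ 'n)"
      by (simp add: map_matrix_def mat_def vec_eq_iff rat_incl_1)
    ultimately show ?thesis using qeval_rat_incl[OF invertible_mat_1, of p, where 'a = 'a] by simp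
  qed
  then show ?thesis by (simp add: pts_def invertible_mat_1)
qed

text \<open>Each defining equation at a product is an identity in two points; it holds for complex
  points because \<open>H\<close> is a group there.\<close>

lemma pts_mult:
  fixes g h :: "'a::separated_algebra ^ 'n ^ 'n"
  assumes H: "q_group H" and gh: "g \<in> pts H" "h \<in> pts H"
  shows "g ** h \<in> pts H"
proof -
  have "qeval p (g ** h) = 0" if p: "p \<in> vanishing_ideal H" for p
  proof (rule pts_identity[OF gh])
    fix \<rho> Z g' h' assume *: "residue_embedding \<rho> Z" "gl_rel \<rho> g g'" "gl_rel \<rho> h h'"
      "g' \<in> pts H" "h' \<in> pts H"
    interpret residue_embedding \<rho> Z by fact
    have "qeval p (g' ** h') = 0" using q_group_closed(2)[OF H *(4,5)] p by (simp add: pts_def)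
    then show "(qeval p (g ** h), 0) \<in> \<rho>" using rel_qeval[OF gl_rel_mult[OF *(2,3)], of p] by simp
  qed
  then show ?thesis using gh by (simp add: pts_def invertible_times)
qed

lemma pts_inv:
  fixes g :: "'a::separated_algebra ^ 'n ^ 'n"
  assumes H: "q_group H" and g: "g \<in> pts H"
  shows "matrix_inv g \<in> pts H"
proof -
  have "qeval p (matrix_inv g) = 0" if p: "p \<in> vanishing_ideal H" for p
  proof (rule pts_identity[OF g g])
    fix \<rho> Z g' h' assume *: "residue_embedding \<rho> Z" "gl_rel \<rho> g g'" "g' \<in> pts H"
    interpret residue_embedding \<rho> Z by fact
    have "qeval p (matrix_inv g') = 0" using q_group_closed(3)[OF H *(3)] p by (simp add: pts_def)
    then show "(qeval p (matrix_inv g), 0) \<in> \<rho>" using rel_qeval[OF gl_rel_inv[OF *(2)], of p] by simp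
  qed
  then show ?thesis using g by (simp add: pts_def invertible_matrix_inv)
qed

text \<open>\<open>qchars\<close> demands multiplicativity at complex points only; here it is
  carried to the rational, real and finite adelic points.\<close>

lemma qchar_mult:
  fixes g h :: "'a::separated_algebra ^ 'n ^ 'n"
  assumes H: "q_group H" and gh: "g \<in> pts H" "h \<in> pts H" and \<psi>: "\<psi> \<in> qchars H"
  shows "qeval \<psi> (g ** h) = qeval \<psi> g * qeval \<psi> h"
proof -
  have "qeval \<psi> (g ** h) - qeval \<psi> g * qeval \<psi> h = 0"
  proof (rule pts_identity[OF gh])
    fix \<rho> Z g' h' assume *: "residue_embedding \<rho> Z" "gl_rel \<rho> g g'" "gl_rel \<rho> h h'"
      "g' \<in> pts H" "h' \<in> pts H"
    interpret residue_embedding \<rho> Z by fact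
    have "qeval \<psi> (g' ** h') = qeval \<psi> g' * qeval \<psi> h'"
      using \<psi> *(4,5) H by (simp add: qchars_def q_group_def)
    then show "(qeval \<psi> (g ** h) - qeval \<psi> g * qeval \<psi> h, 0) \<in> \<rho>"
      using rel_diff[OF rel_qeval[OF gl_rel_mult[OF *(2,3)], of \<psi>]
          rel_mult[OF rel_qeval[OF *(2), of \<psi>] rel_qeval[OF *(3), of \<psi>]]] by simp
  qed
  then show ?thesis by simp
qed

lemma qchar_one:
  assumes H: "q_group H" and \<psi>: "\<psi> \<in> qchars H"
  shows "qeval \<psi> (mat 1 :: 'a::separated_algebra ^ 'n ^ 'n) = 1"
proof -
  have "qeval \<psi> (mat 1 :: 'a ^ 'n ^ 'n) - 1 = 0"
  proof (rule pts_identity[OF pts_one[OF H] pts_one[OF H]])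
    fix \<rho> :: "('a \<times> complex) set" and Z assume *: "residue_embedding \<rho> Z"
    interpret residue_embedding \<rho> Z by fact
    have "qeval \<psi> (mat 1 :: complex ^ 'n ^ 'n) = 1" using \<psi> by (simp add: qchars_def)
    then show "(qeval \<psi> (mat 1 :: 'a ^ 'n ^ 'n) - 1, 0) \<in> \<rho>"
      using rel_diff[OF rel_qeval[OF gl_rel_1, of \<psi>] rel_1] by simp
  qed
  then show ?thesis by simp
qed

section \<open>Rational characters on unipotent and compact elements\<close>

lemma qeval_superset:
  assumes "finite S" "Poly_Mapping.keys p \<subseteq> S"
  shows "qeval p g = (\<Sum>m\<in>S. rat_incl (Poly_Mapping.lookup p m) *
     (\<Prod>v\<in>Poly_Mapping.keys m. gl_coord g v ^ Poly_Mapping.lookup m v))"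
  unfolding gl_eval_def
  by (rule sum.mono_neutral_left) (use assms in \<open>auto simp: in_keys_iff\<close>)

lemma qeval_diff: "qeval (p - q) g = qeval p g - qeval q g"
proof -
  let ?S = "Poly_Mapping.keys p \<union> Poly_Mapping.keys q"
  have S: "finite ?S" by simp
  have "rat_incl (a - b) = rat_incl a - (rat_incl b :: 'a)" for a b
    using rat_incl_add[of a "- b", where 'a = 'a] by (simp add: rat_incl_minus)
  then show ?thesis
    by (simp add: qeval_superset[OF S, of p g] qeval_superset[OF S, of q g]
        qeval_superset[OF S keys_diff, of g] lookup_minus left_diff_distrib sum_subtractf)
qed

lemma qeval_const: "qeval (Poly_Mapping.single 0 c) g = rat_incl c"
  by (simp add: gl_eval_def)

lemma qeval_1: "qeval 1 g = 1"
  using qeval_const[of 1 g] by (simp add: rat_incl_1)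

lemma qeval_var: "qeval (Poly_Mapping.single (Poly_Mapping.single v 1) 1) g = gl_coord g v"
  by (simp add: gl_eval_def rat_incl_1)

text \<open>Used to see that the integral over the radical of a reductive group runs over a single
  point.\<close>

lemma pts_trivial: "pts {mat 1} \<subseteq> {mat 1 :: 'a::rat_algebra ^ 'n ^ 'n}"
proof
  fix g :: "'a ^ 'n ^ 'n" assume g: "g \<in> pts {mat 1}"
  have "g $ i $ j = mat 1 $ i $ j" for i j
  proof -
    \<comment> \<open>The coordinate function minus the corresponding entry of the identity
      matrix.\<close>
    define p :: "('n, rat) gl_poly" where
      "p = Poly_Mapping.single (Poly_Mapping.single (Some (i, j)) 1) 1
         - Poly_Mapping.single 0 (if i = j then 1 else 0)"
    have eval: "qeval p h = h $ i $ j - mat 1 $ i $ j" for h :: "'b::rat_algebra ^ 'n ^ 'n"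
      unfolding p_def qeval_diff qeval_const qeval_var
      by (simp add: gl_coord_def mat_def rat_incl_1)
    have "p \<in> vanishing_ideal {mat 1}" by (simp add: vanishing_ideal_def eval)
    then have "qeval p g = 0" using g by (simp add: pts_def)
    then show ?thesis by (simp add: eval)
  qed
  then show "g \<in> {mat 1}" by (simp add: vec_eq_iff)
qed

section \<open>Powers of matrices\<close>

definition matpow :: "'a::semiring_1 ^ 'n ^ 'n \<Rightarrow> nat \<Rightarrow> 'a ^ 'n ^ 'n" where
  "matpow g k = (((**) g) ^^ k) (mat 1)"

lemma matpow_0 [simp]: "matpow g 0 = mat 1"
  by (simp add: matpow_def)

lemma matpow_Suc [simp]: "matpow g (Suc k) = g ** matpow g k"
  by (simp add: matpow_def)

lemma matpow_add: "matpow g (k + l) = matpow g k ** matpow g l"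
  by (induction k) (simp_all add: matrix_mul_assoc)

lemma matpow_conj:
  assumes "invertible x"
  shows "matpow (matrix_inv x ** u ** x) k = matrix_inv x ** matpow u k ** x"
proof (induction k)
  case (Suc k)
  have "matrix_inv x ** u ** x ** (matrix_inv x ** matpow u k ** x)
      = matrix_inv x ** u ** (x ** matrix_inv x) ** matpow u k ** x"
    by (simp add: matrix_mul_assoc)
  then show ?case using Suc assms by (simp add: matrix_inv_right matrix_mul_assoc)
qed (use assms in \<open>simp add: matrix_inv_left\<close>)

lemma det_matpow: "det (matpow g k) = det (g :: 'a::comm_ring_1 ^ 'n ^ 'n) ^ k"
  by (induction k) (simp_all add: det_mul)

lemma invertible_matpow: "invertible g \<Longrightarrow> invertible (matpow g k)"
  by (induction k) (simp_all add: invertible_mat_1 invertible_times)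

lemma matrix_mul_add_right: "(A + B) ** C = A ** C + B ** (C :: 'a::semiring_1 ^ 'n ^ 'n)"
  by (simp add: matrix_matrix_mult_def vec_eq_iff distrib_right sum.distrib)

text \<open>Stated for entries because \<open>*\<close> on the matrix type is componentwise. The
  induction is Pascal's rule.\<close>

lemma matpow_binomial:
  fixes N :: "'a::comm_ring_1 ^ 'n ^ 'n"
  shows "matpow (mat 1 + N) k $ a $ b = (\<Sum>i\<le>k. of_nat (k choose i) * matpow N i $ a $ b)"
proof (induction k arbitrary: a)
  case (Suc k)
  let ?x = "\<lambda>i. matpow N i $ a $ b"
  have "(N ** matpow (mat 1 + N) k) $ a $ b
      = (\<Sum>c\<in>UNIV. \<Sum>i\<le>k. of_nat (k choose i) * (N $ a $ c * matpow N i $ c $ b))"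
    by (simp add: matrix_matrix_mult_def Suc.IH sum_distrib_left mult.left_commute)
  also have "\<dots> = (\<Sum>i\<le>k. of_nat (k choose i) * ?x (Suc i))"
    by (subst sum.swap) (simp add: matrix_matrix_mult_def sum_distrib_left)
  finally have "matpow (mat 1 + N) (Suc k) $ a $ b
      = (\<Sum>i\<le>k. of_nat (k choose i) * ?x i) + (\<Sum>i\<le>k. of_nat (k choose i) * ?x (Suc i))"
    by (simp add: matrix_mul_add_right Suc.IH)
  \<comment> \<open>The added term is 0; with it both sides can be split off at index 0 and compared
    by Pascal's rule.\<close>
  also have "(\<Sum>i\<le>k. of_nat (k choose i) * ?x i) = (\<Sum>i\<le>Suc k. of_nat (k choose i) * ?x i)"
    by (simp add: binomial_eq_0)
  also have "\<dots> = ?x 0 + (\<Sum>i\<le>k. of_nat (k choose Suc i) * ?x (Suc i))"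
    by (subst sum.atMost_Suc_shift) simp
  also have "\<dots> + (\<Sum>i\<le>k. of_nat (k choose i) * ?x (Suc i))
      = (\<Sum>i\<le>Suc k. of_nat (Suc k choose i) * ?x i)"
    by (subst sum.atMost_Suc_shift) (simp add: sum.distrib distrib_right del: matpow_Suc)
  finally show ?case .
qed simp

section \<open>Polynomial functions of the exponent\<close>

definition poly_fun :: "(nat \<Rightarrow> complex) \<Rightarrow> bool" where
  "poly_fun F \<longleftrightarrow> (\<exists>q. \<forall>k. F k = poly q (of_nat k))"

lemma poly_fun_const: "poly_fun (\<lambda>_. c)"
  unfolding poly_fun_def by (rule exI[of _ "[:c:]"]) simp

lemma poly_fun_of_nat: "poly_fun of_nat"
  unfolding poly_fun_def by (rule exI[of _ "[:0, 1:]"]) simp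

lemma poly_fun_add: "poly_fun F \<Longrightarrow> poly_fun G \<Longrightarrow> poly_fun (\<lambda>k. F k + G k)"
  unfolding poly_fun_def by (metis poly_add)

lemma poly_fun_diff: "poly_fun F \<Longrightarrow> poly_fun G \<Longrightarrow> poly_fun (\<lambda>k. F k - G k)"
  unfolding poly_fun_def by (metis poly_diff)

lemma poly_fun_mult: "poly_fun F \<Longrightarrow> poly_fun G \<Longrightarrow> poly_fun (\<lambda>k. F k * G k)"
  unfolding poly_fun_def by (metis poly_mult)

lemma poly_fun_sum: "(\<And>i. i \<in> I \<Longrightarrow> poly_fun (F i)) \<Longrightarrow> poly_fun (\<lambda>k. \<Sum>i\<in>I. F i k)"
  by (induction I rule: infinite_finite_induct) (auto intro: poly_fun_const poly_fun_add)

lemma poly_fun_prod: "(\<And>i. i \<in> I \<Longrightarrow> poly_fun (F i)) \<Longrightarrow> poly_fun (\<lambda>k. \<Prod>i\<in>I. F i k)"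
  by (induction I rule: infinite_finite_induct) (auto intro: poly_fun_const poly_fun_mult)

lemma poly_fun_power: "poly_fun F \<Longrightarrow> poly_fun (\<lambda>k. F k ^ n)"
  by (induction n) (auto intro: poly_fun_const poly_fun_mult)

lemma poly_fun_binomial: "poly_fun (\<lambda>k. of_nat (k choose i))"
proof -
  have "of_nat (k choose i) = (\<Prod>j=0..<i. of_nat k - of_nat j) * (1 / fact i :: complex)" for k
    by (simp add: binomial_gbinomial gbinomial_prod_rev)
  then show ?thesis
    by (simp only:) (intro poly_fun_mult poly_fun_prod poly_fun_diff poly_fun_const poly_fun_of_nat)
qed

text \<open>The polynomial q(X + 1) - c q(X) has every natural number as a root and so is 0; since
  the shift preserves the leading coefficient, c is 1.\<close>

lemma poly_fun_exponential:
  assumes "c \<noteq> 0" "poly_fun (\<lambda>k. c ^ k)" shows "c = 1"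
proof -
  obtain q where q: "\<And>k. c ^ k = poly q (of_nat k)" using assms(2) by (auto simp: poly_fun_def)
  define r where "r = pcompose q [:1, 1:] - smult c q"
  have "poly r (of_nat k) = 0" for k
    using q[of "Suc k"] q[of k] by (simp add: r_def poly_pcompose add.commute)
  then have "range of_nat \<subseteq> {z. poly r z = 0}" by blast
  then have "infinite {z. poly r z = 0}"
    using finite_subset range_inj_infinite[OF inj_of_nat] by blast
  then have "r = 0" using poly_roots_finite by blast
  then have "lead_coeff (pcompose q [:1, 1:]) = c * lead_coeff q" by (simp add: r_def)
  moreover have "lead_coeff (pcompose q [:1, 1:]) = lead_coeff q"
    by (subst lead_coeff_comp) auto
  moreover have "q \<noteq> 0" using q[of 0] by auto
  ultimately show ?thesis by simp
qed

text \<open>The values of a character at the powers of a unipotent element depend polynomially on the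
  exponent, but form a geometric progression.\<close>

lemma qchar_unipotent:
  fixes g :: "complex ^ 'n ^ 'n"
  assumes H: "q_group H" and g: "g \<in> H" and u: "unipotent g" and \<psi>: "\<psi> \<in> qchars H"
  shows "qeval \<psi> g = 1"
proof -
  have gp: "g \<in> pts H" and Hp: "pts H = H" using H g by (auto simp: q_group_def)
  have inv: "invertible g" using gp by (simp add: pts_def)
  define N where "N = g - mat 1"
  obtain m where m: "matpow N m = 0" using u by (auto simp: unipotent_def matpow_def N_def)
  have null: "matpow N i = 0" if "i \<ge> m" for i
    using matpow_add[of N "i - m" m] m that by simp
  have "matpow g k $ a $ b = (\<Sum>i<m. of_nat (k choose i) * matpow N i $ a $ b)" for k a b
  proof -
    have "matpow g k $ a $ b = (\<Sum>i\<le>k. of_nat (k choose i) * matpow N i $ a $ b)"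
      using matpow_binomial[of N k a b] by (simp add: N_def)
    \<comment> \<open>The common range covers both sums: beyond \<open>k\<close> the binomial
      coefficients vanish, from \<open>m\<close> on the powers of \<open>N\<close>. The number of
      terms no longer depends on \<open>k\<close>.\<close>
    also have "\<dots> = (\<Sum>i<max m (Suc k). of_nat (k choose i) * matpow N i $ a $ b)"
      by (rule sum.mono_neutral_left) auto
    also have "\<dots> = (\<Sum>i<m. of_nat (k choose i) * matpow N i $ a $ b)"
      by (rule sum.mono_neutral_right) (auto simp: null)
    finally show ?thesis .
  qed
  then have entries: "poly_fun (\<lambda>k. matpow g k $ a $ b)" for a b
    by (simp only:) (intro poly_fun_sum poly_fun_mult poly_fun_binomial poly_fun_const)
  \<comment> \<open>The coordinate for the inverse determinant is handled by showing that it is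
    constantly 1.\<close>
  have "poly_fun (\<lambda>k. det (matpow g k))"
    unfolding det_def by (intro poly_fun_sum poly_fun_mult poly_fun_prod poly_fun_const entries)
  moreover have "det g \<noteq> 0" using inv by (simp add: invertible_det_nz)
  ultimately have "det g = 1" by (intro poly_fun_exponential) (simp_all add: det_matpow)
  then have "det (matrix_inv (matpow g k)) = 1" for k
    using det_mul[of "matpow g k" "matrix_inv (matpow g k)"]
      matrix_inv_right[OF invertible_matpow[OF inv, of k]] by (simp add: det_matpow)
  then have "poly_fun (\<lambda>k. gl_coord (matpow g k) v)" for v
    by (cases v) (auto simp: gl_coord_def intro: poly_fun_const entries)
  then have "poly_fun (\<lambda>k. qeval \<psi> (matpow g k))"
    unfolding gl_eval_def
    by (intro poly_fun_sum poly_fun_mult poly_fun_prod poly_fun_const poly_fun_power)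
  moreover have "matpow g k \<in> H \<and> qeval \<psi> (matpow g k) = qeval \<psi> g ^ k" for k
  proof (induction k)
    case 0
    then show ?case using q_group_closed(1)[OF H] \<psi> Hp by (simp add: qchars_def)
  next
    case (Suc k)
    then show ?case using q_group_closed(2)[OF H gp, of "matpow g k"] \<psi> Hp g by (simp add: qchars_def)
  qed
  moreover have "qeval \<psi> g * qeval \<psi> (matrix_inv g) = 1"
    using q_group_closed(3)[OF H gp] \<psi> Hp g matrix_inv_right[OF inv]
    by (auto simp: qchars_def) (metis g)
  then have "qeval \<psi> g \<noteq> 0" by auto
  ultimately show ?thesis by (intro poly_fun_exponential) auto
qed

text \<open>Triviality on the complex points puts \<open>\<psi> - 1\<close> into the vanishing ideal
  of \<open>N\<close>, hence holds over every algebra.\<close>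

lemma qchar_unipotent_pts:
  fixes n :: "'a::rat_algebra ^ 'n ^ 'n"
  assumes "q_group H" "N \<subseteq> H" "\<forall>g\<in>N. unipotent g" "\<psi> \<in> qchars H" "n \<in> pts N"
  shows "qeval \<psi> n = 1"
proof -
  have "\<psi> - 1 \<in> vanishing_ideal N"
    using qchar_unipotent[OF assms(1) _ _ assms(4)] assms(2,3)
    by (auto simp: vanishing_ideal_def qeval_diff qeval_1)
  then have "qeval (\<psi> - 1) n = 0" using assms(5) by (simp add: pts_def)
  then show ?thesis by (simp add: qeval_diff qeval_1)
qed

section \<open>Boundedness at a prime and compact groups\<close>

definition padic_bounded :: "nat \<Rightarrow> ('i \<Rightarrow> fadele) \<Rightarrow> bool" where
  "padic_bounded p F \<longleftrightarrow> (\<exists>B. \<forall>i. fadele_abs p (F i) \<le> B)"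

context
  fixes p :: nat assumes p: "prime p"
begin

lemma padic_bounded_const: "padic_bounded p (\<lambda>_. c)"
  by (auto simp: padic_bounded_def)

lemma padic_bounded_add:
  assumes "padic_bounded p F" "padic_bounded p G" shows "padic_bounded p (\<lambda>i. F i + G i)"
proof -
  obtain B C where "\<And>i. fadele_abs p (F i) \<le> B" "\<And>i. fadele_abs p (G i) \<le> C"
    using assms by (auto simp: padic_bounded_def)
  then have "fadele_abs p (F i + G i) \<le> max B C" for i
    using fadele_abs_ultra[OF p, of "F i" "G i"] by (meson max.mono order_trans)
  then show ?thesis by (auto simp: padic_bounded_def)
qed

lemma padic_bounded_mult:
  assumes "padic_bounded p F" "padic_bounded p G" shows "padic_bounded p (\<lambda>i. F i * G i)"
proof -
  obtain B C where BC: "\<And>i. fadele_abs p (F i) \<le> B" "\<And>i. fadele_abs p (G i) \<le> C"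
    using assms by (auto simp: padic_bounded_def)
  then have "fadele_abs p (F i * G i) \<le> B * C" for i
    using fadele_abs_nonneg[OF p] unfolding fadele_abs_mult[OF p]
    by (intro mult_mono) (auto intro: order_trans)
  then show ?thesis by (auto simp: padic_bounded_def)
qed

lemma padic_bounded_sum:
  "(\<And>a. a \<in> A \<Longrightarrow> padic_bounded p (F a)) \<Longrightarrow> padic_bounded p (\<lambda>i. \<Sum>a\<in>A. F a i)"
  by (induction A rule: infinite_finite_induct) (auto intro: padic_bounded_const padic_bounded_add)

lemma padic_bounded_prod:
  "(\<And>a. a \<in> A \<Longrightarrow> padic_bounded p (F a)) \<Longrightarrow> padic_bounded p (\<lambda>i. \<Prod>a\<in>A. F a i)"
  by (induction A rule: infinite_finite_induct) (auto intro: padic_bounded_const padic_bounded_mult)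

lemma padic_bounded_power: "padic_bounded p F \<Longrightarrow> padic_bounded p (\<lambda>i. F i ^ n)"
  by (induction n) (auto intro: padic_bounded_const padic_bounded_mult)

lemma padic_bounded_matrix_mult:
  assumes "\<And>a b. padic_bounded p (\<lambda>i. F i $ a $ b)" "\<And>a b. padic_bounded p (\<lambda>i. G i $ a $ b)"
  shows "padic_bounded p (\<lambda>i. (F i ** G i) $ a $ b)"
  unfolding matrix_matrix_mult_def by (simp add: padic_bounded_sum padic_bounded_mult assms)

lemma padic_bounded_qeval:
  assumes "\<And>a b. padic_bounded p (\<lambda>i. F i $ a $ b)"
    and "\<And>a b. padic_bounded p (\<lambda>i. matrix_inv (F i) $ a $ b)"
  shows "padic_bounded p (\<lambda>i. qeval \<psi> (F i))"
proof -
  have "padic_bounded p (\<lambda>i. det (matrix_inv (F i)))"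
    unfolding det_def
    by (intro padic_bounded_sum padic_bounded_mult padic_bounded_prod padic_bounded_const assms)
  then have "padic_bounded p (\<lambda>i. gl_coord (F i) v)" for v
    using assms(1) by (cases v) (auto simp: gl_coord_def)
  then show ?thesis unfolding gl_eval_def
    by (intro padic_bounded_sum padic_bounded_mult padic_bounded_prod padic_bounded_const
        padic_bounded_power)
qed

lemma padic_bounded_powers:
  assumes "padic_bounded p (\<lambda>k. c ^ k)" shows "fadele_abs p c \<le> 1"
proof (rule ccontr)
  assume c: "\<not> fadele_abs p c \<le> 1"
  obtain B where B: "\<And>k. fadele_abs p (c ^ k) \<le> B" using assms by (auto simp: padic_bounded_def)
  have "fadele_abs p (c ^ k) = fadele_abs p c ^ k" for k
    by (induction k) (simp_all add: p fadele_abs_mult[OF p])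
  then show False using B real_arch_pow[of "fadele_abs p c" B] c by (metis not_le)
qed

lemma open_padic_ball:
  assumes "B \<ge> 1" shows "open {x. fadele_abs p x \<le> B}"
  unfolding open_fadele_def
\<comment> \<open>Radius 1 at every prime defines a basic neighbourhood, and since
  \<open>B \<ge> 1\<close> the ultrametric inequality keeps it inside the ball.\<close>
proof (intro ballI exI[of _ "\<lambda>_. 1"] conjI)
  fix x assume x: "x \<in> {x. fadele_abs p x \<le> B}"
  show "{y. \<forall>q. prime q \<longrightarrow> fadele_abs q (y - x) \<le> 1} \<subseteq> {x. fadele_abs p x \<le> B}"
  proof
    fix y assume "y \<in> {y. \<forall>q. prime q \<longrightarrow> fadele_abs q (y - x) \<le> 1}"
    then have "fadele_abs p (y - x) \<le> 1" using p by blast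
    then have "fadele_abs p (y - x) \<le> B" using assms by linarith
    then show "y \<in> {x. fadele_abs p x \<le> B}"
      using fadele_abs_ultra[OF p, of "y - x" x] x by simp
  qed
qed auto

text \<open>The sets \<open>U m\<close> form an increasing open cover, so one of them contains
  \<open>C\<close>. The embedding by matrix and inverse in \<open>pts_top\<close> bounds both at
  once.\<close>

lemma compactin_pts_bounded:
  fixes C :: "(fadele ^ 'n ^ 'n) set"
  assumes "compactin (pts_top G) C"
  obtains B where "\<And>g i j. g \<in> C \<Longrightarrow> fadele_abs p (g $ i $ j) \<le> B"
    "\<And>g i j. g \<in> C \<Longrightarrow> fadele_abs p (matrix_inv g $ i $ j) \<le> B"
proof -
  define V :: "nat \<Rightarrow> (fadele ^ 'n ^ 'n) set" where
    \<comment> \<open>The radius is \<open>Suc m\<close> because \<open>open_padic_ball\<close> asks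
      for a radius of at least 1.\<close>
    "V m = {A. \<forall>i. A $ i \<in> {r. \<forall>j. r $ j \<in> {x. fadele_abs p x \<le> real (Suc m)}}}" for m
  have V: "open (V m)" for m
    unfolding V_def by (intro open_vector_box allI open_padic_ball) simp
  define U where "U m = (\<lambda>g. (g, matrix_inv g)) -` (V m \<times> V m) \<inter> pts G" for m
  have U: "openin (pts_top G) (U m)" for m
    unfolding pts_top_def openin_pullback_topology U_def using V open_Times by auto
  have mono: "U m \<subseteq> U m'" if "m \<le> m'" for m m'
  proof -
    have "x \<le> real (Suc m)  \<Longrightarrow> x \<le> real (Suc m')" for x using that by simp
    then have "V m \<subseteq> V m'" unfolding V_def by blast
    then show ?thesis by (auto simp: U_def)
  qed
  have C: "C \<subseteq> pts G" 
    using compactin_subset_topspace[OF assms] by (simp add: pts_top_def topspace_pullback_topology)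
  have cover: "C \<subseteq> \<Union>(range U)"
  proof
    fix g assume g: "g \<in> C"
    define S where "S = (\<Sum>i\<in>UNIV. \<Sum>j\<in>UNIV. fadele_abs p (g $ i $ j) + fadele_abs p (matrix_inv g $ i $ j))"
    have le: "fadele_abs p (g $ i $ j) + fadele_abs p (matrix_inv g $ i $ j) \<le> S" for i j
    proof -
      have "fadele_abs p (g $ i $ j) + fadele_abs p (matrix_inv g $ i $ j)
          \<le> (\<Sum>j\<in>UNIV. fadele_abs p (g $ i $ j) + fadele_abs p (matrix_inv g $ i $ j))"
        by (rule member_le_sum[of j UNIV "\<lambda>j. fadele_abs p (g $ i $ j) + fadele_abs p (matrix_inv g $ i $ j)"])
           (auto intro!: add_nonneg_nonneg fadele_abs_nonneg p)
      also have "\<dots> \<le> S" unfolding S_def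
        by (rule member_le_sum[of i UNIV "\<lambda>i. \<Sum>j\<in>UNIV. fadele_abs p (g $ i $ j) + fadele_abs p (matrix_inv g $ i $ j)"])
           (auto intro!: sum_nonneg add_nonneg_nonneg fadele_abs_nonneg p)
      finally show ?thesis .
    qed
    obtain m where m: "S \<le> real m" using real_arch_simple by blast
    have "fadele_abs p (g $ i $ j) \<le> real (Suc m)" "fadele_abs p (matrix_inv g $ i $ j) \<le> real (Suc m)" for i j
      using le[of i j] m fadele_abs_nonneg[OF p, of "g $ i $ j"]
        fadele_abs_nonneg[OF p, of "matrix_inv g $ i $ j"] by auto
    then have "g \<in> U m" using g C by (auto simp: U_def V_def)
    then show "g \<in> \<Union>(range U)" by blast
  qed
  then obtain \<F> where \<F>: "finite \<F>" "\<F> \<subseteq> range U" "C \<subseteq> \<Union>\<F>"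
    using assms U unfolding compactin_def by (metis (no_types, lifting) imageE)
  obtain M where M: "finite M" "\<F> = U ` M" using finite_subset_image[OF \<F>(1,2)] by blast
  obtain m where m: "\<And>k. k \<in> M \<Longrightarrow> k \<le> m" using M(1) by (meson finite_nat_set_iff_bounded_le)
  have "C \<subseteq> U m" using \<F>(3) M(2) mono m by blast
  then show thesis by (intro that[of "real (Suc m)"]) (auto simp: U_def V_def)
qed

text \<open>A character is bounded on the powers of an element of a compact group, so it has absolute
  value 1 there.\<close>

lemma qchar_compact_le:
  fixes u x :: "fadele ^ 'n ^ 'n"
  assumes P: "q_group P" and u: "u \<in> pts P" and x: "invertible x"
    and K: "subgroup K gl" "compactin (pts_top G) K" "matrix_inv x ** u ** x \<in> K"
    and \<psi>: "\<psi> \<in> qchars P"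
  shows "fadele_abs p (qeval \<psi> u) \<le> 1"
proof -
  define k where "k = matrix_inv x ** u ** x"
  have iu: "invertible u" using u by (simp add: pts_def)
  have ix: "invertible (matrix_inv x)" "matrix_inv (matrix_inv x) = x"
    using x by (simp_all add: invertible_matrix_inv matrix_inv_inv)
  have ik: "invertible k" unfolding k_def by (intro invertible_times ix iu x)
  have kK: "matpow k m \<in> K" for m
  proof (induction m)
    case 0
    show ?case using subgroup.one_closed[OF K(1)] by (simp add: gl_def)
  next
    case (Suc m)
    show ?case using subgroup.m_closed[OF K(1,3)] Suc by (simp add: gl_def k_def)
  qed
  have "x ** k ** matrix_inv x = (x ** matrix_inv x) ** u ** (x ** matrix_inv x)"
    by (simp add: k_def matrix_mul_assoc)
  \<comment> \<open>Powers of \<open>u\<close> are conjugates of elements of \<open>K\<close> by the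
    fixed matrix \<open>x\<close>, so their entries stay bounded.\<close>
  then have "u = x ** k ** matrix_inv x" using x by (simp add: matrix_inv_right)
  then have pow: "matpow u m = x ** matpow k m ** matrix_inv x" for m
    using matpow_conj[OF ix(1), of k m] by (simp add: ix(2))
  have inv: "matrix_inv (matpow u m) = x ** matrix_inv (matpow k m) ** matrix_inv x" for m
    unfolding pow
    by (simp add: invertible_times x ix invertible_matpow[OF ik] matrix_mul_assoc)
  obtain B where B: "\<And>g i j. g \<in> K \<Longrightarrow> fadele_abs p (g $ i $ j) \<le> B"
    "\<And>g i j. g \<in> K \<Longrightarrow> fadele_abs p (matrix_inv g $ i $ j) \<le> B"
    using compactin_pts_bounded[OF K(2)] by blast
  have "padic_bounded p (\<lambda>m. matpow k m $ i $ j)" "padic_bounded p (\<lambda>m. matrix_inv (matpow k m) $ i $ j)" for i j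
    using B kK unfolding padic_bounded_def by blast+
  note bdd = this
  have "padic_bounded p (\<lambda>m. matpow u m $ i $ j)" for i j
    unfolding pow by (intro padic_bounded_matrix_mult padic_bounded_const bdd)
  moreover have "padic_bounded p (\<lambda>m. matrix_inv (matpow u m) $ i $ j)" for i j
    unfolding inv by (intro padic_bounded_matrix_mult padic_bounded_const bdd)
  ultimately have "padic_bounded p (\<lambda>m. qeval \<psi> (matpow u m))" by (rule padic_bounded_qeval)
  moreover have "matpow u m \<in> pts P \<and> qeval \<psi> (matpow u m) = qeval \<psi> u ^ m" for m
    by (induction m)
       (simp_all add: pts_one[OF P] qchar_one[OF P \<psi>] pts_mult[OF P u] qchar_mult[OF P u _ \<psi>])
  ultimately show ?thesis using padic_bounded_powers by simp
qed

text \<open>The upper bound also applies to the inverse of \<open>u\<close>, and the two values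
  multiply to 1.\<close>

lemma qchar_compact:
  fixes u x :: "fadele ^ 'n ^ 'n"
  assumes P: "q_group P" and u: "u \<in> pts P" and x: "invertible x"
    and K: "subgroup K gl" "compactin (pts_top G) K" "matrix_inv x ** u ** x \<in> K"
    and \<psi>: "\<psi> \<in> qchars P"
  shows "fadele_abs p (qeval \<psi> u) = 1"
proof -
  have iu: "invertible u" using u by (simp add: pts_def)
  have ik: "invertible (matrix_inv x ** u ** x)"
    by (intro invertible_times invertible_matrix_inv iu x)
  have "matrix_inv (matrix_inv x ** u ** x) \<in> K"
    using subgroup.m_inv_closed[OF K(1,3)] inv_gl[OF ik] by simp
  then have "matrix_inv x ** matrix_inv u ** x \<in> K"
    using x iu by (simp add: invertible_times invertible_matrix_inv matrix_inv_inv matrix_mul_assoc)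
  then have "fadele_abs p (qeval \<psi> (matrix_inv u)) \<le> 1"
    by (rule qchar_compact_le[OF P pts_inv[OF P u] x K(1,2) _ \<psi>])
  moreover have le: "fadele_abs p (qeval \<psi> u) \<le> 1" by (rule qchar_compact_le[OF assms])
  moreover have "qeval \<psi> u * qeval \<psi> (matrix_inv u) = 1"
    using qchar_mult[OF P u pts_inv[OF P u] \<psi>] by (simp add: matrix_inv_right[OF iu] qchar_one[OF P \<psi>])
  then have "fadele_abs p (qeval \<psi> u) * fadele_abs p (qeval \<psi> (matrix_inv u)) = 1"
    by (metis fadele_abs_mult[OF p] fadele_abs_1[OF p])
  ultimately show ?thesis
    using fadele_abs_nonneg[OF p, of "qeval \<psi> u"] by (smt (verit) mult_left_le)
qed

end

section \<open>The product formula\<close>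

text \<open>The primes range over the divisors of a multiple \<open>c\<close> of \<open>a\<close>,
  so that numerator and denominator can share one index set.\<close>

lemma prod_nat_prime_powers:
  fixes a c :: int
  assumes "c \<noteq> 0" "a dvd c"
  shows "(\<Prod>p\<in>nat ` prime_factors c. real p ^ multiplicity (int p) a) = \<bar>real_of_int a\<bar>"
proof -
  have a: "a \<noteq> 0" using assms by auto
  have "inj_on nat (prime_factors c)"
    by (rule inj_onI) (metis in_prime_factors_imp_prime int_nat_eq prime_ge_0_int)
  then have "(\<Prod>p\<in>nat ` prime_factors c. real p ^ multiplicity (int p) a)
      = (\<Prod>p\<in>prime_factors c. real (nat p) ^ multiplicity (int (nat p)) a)"
    by (simp add: prod.reindex)
  also have "\<dots> = (\<Prod>p\<in>prime_factors c. real_of_int p ^ multiplicity p a)"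
    by (rule prod.cong) (auto simp: prime_ge_0_int dest: in_prime_factors_imp_prime)
  also have "\<dots> = (\<Prod>p\<in>prime_factors a. real_of_int p ^ multiplicity p a)"
  proof (rule prod.mono_neutral_right)
    show "prime_factors a \<subseteq> prime_factors c" using assms by (rule dvd_prime_factors)
    show "\<forall>p\<in>prime_factors c - prime_factors a. real_of_int p ^ multiplicity p a = 1"
      using a by (auto simp: in_prime_factors_iff not_dvd_imp_multiplicity_0)
  qed simp
  also have "\<dots> = real_of_int (\<Prod>p\<in>prime_factors a. p ^ multiplicity p a)" by simp
  also have "\<dots> = \<bar>real_of_int a\<bar>" using prod_prime_factors[OF a] by simp
  finally show ?thesis .
qed

text \<open>The finite places multiply to the absolute value of the denominator over that of the
  numerator, which the real place cancels.\<close>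

lemma product_formula:
  assumes "q \<noteq> 0" shows "adele_abs (rat_incl q, rat_incl q) = 1"
proof -
  obtain a b where ab: "quotient_of q = (a, b)" by fastforce
  have b: "b > 0" using quotient_of_denom_pos[OF ab] .
  have q: "q = of_int a / of_int b" using quotient_of_div[OF ab] .
  have a: "a \<noteq> 0" using assms q by auto
  define D where "D = nat ` prime_factors (a * b)"
  have D: "prime p" if "p \<in> D" for p
    using that by (auto simp: D_def dest!: in_prime_factors_imp_prime)
  have abs: "padic_abs p q = real p ^ multiplicity (int p) b / real p ^ multiplicity (int p) a"
    if "prime p" for p
    using padic_abs_fraction[OF that a, of b] b prime_gt_0_nat[OF that]
    by (simp add: q power_int_diff)
  have "(\<Prod>p | prime p \<and> fadele_abs p (rat_incl q) \<noteq> 1. fadele_abs p (rat_incl q))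
      = (\<Prod>p\<in>D. fadele_abs p (rat_incl q))"
  proof (rule prod.mono_neutral_left)
    show "{p. prime p \<and> fadele_abs p (rat_incl q) \<noteq> 1} \<subseteq> D"
    proof clarify
      fix p :: nat assume p: "prime p" and "fadele_abs p (rat_incl q) \<noteq> 1"
      then have "int p dvd a \<or> int p dvd b"
        using abs[OF p] by (metis div_by_1 fadele_abs_rat not_dvd_imp_multiplicity_0 power_0)
      then have "int p \<in> prime_factors (a * b)"
        using p a b by (auto simp: in_prime_factors_iff)
      then show "p \<in> D" unfolding D_def by (metis image_eqI nat_int)
    qed
  qed (use D in \<open>auto simp: D_def\<close>)
  also have "\<dots> = (\<Prod>p\<in>D. real p ^ multiplicity (int p) b / real p ^ multiplicity (int p) a)"
    by (rule prod.cong) (use D abs fadele_abs_rat in auto)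
  also have "\<dots> = \<bar>real_of_int b\<bar> / \<bar>real_of_int a\<bar>"
    unfolding prod_dividef D_def using a b by (simp add: prod_nat_prime_powers)
  finally show ?thesis
    using a b by (simp add: adele_abs_def rat_incl_real_def q of_rat_divide)
qed

text \<open>The index set of the finite product is empty, so the product formula reduces to its real
  factor.\<close>

lemma rat_abs_eq_1:
  assumes "\<And>p. prime p \<Longrightarrow> padic_abs p q = 1" shows "\<bar>of_rat q :: real\<bar> = 1"
proof -
  have "q \<noteq> 0" using assms[OF two_is_prime_nat] by auto
  moreover have "{p. prime p \<and> fadele_abs p (rat_incl q) \<noteq> 1} = {}"
    using assms by (auto simp: fadele_abs_rat)
  ultimately show ?thesis
    using product_formula[of q] by (simp add: adele_abs_def rat_incl_real_def)
qed

section \<open>Vanishing of the kernels\<close>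

lemma group_gl: "group (gl :: ('a::comm_ring_1 ^ 'n ^ 'n) monoid)"
proof (rule groupI)
  fix g :: "'a ^ 'n ^ 'n" assume "g \<in> carrier gl"
  then show "\<exists>h\<in>carrier gl. h \<otimes>\<^bsub>gl\<^esub> g = \<one>\<^bsub>gl\<^esub>"
    by (intro bexI[of _ "matrix_inv g"]) (auto simp: gl_def matrix_inv_left invertible_matrix_inv)
qed (auto simp: gl_def invertible_times invertible_mat_1 matrix_mul_assoc)

lemma adele_mult: "(a, b) \<otimes>\<^bsub>adele_gl\<^esub> (c, d) = (a ** c, b ** d)"
  by (simp add: adele_gl_def gl_def)

lemma adele_inv:
  "invertible a \<Longrightarrow> invertible b \<Longrightarrow> inv\<^bsub>adele_gl\<^esub> (a, b) = (matrix_inv a, matrix_inv b)"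
  unfolding adele_gl_def
  by (subst inv_DirProd[OF group_gl group_gl]) (simp_all add: gl_def inv_gl[unfolded gl_def])

lemma qchar_conj:
  fixes x u :: "'a::separated_algebra ^ 'n ^ 'n"
  assumes G: "q_group G" and x: "x \<in> pts G" and u: "u \<in> pts G" and \<psi>: "\<psi> \<in> qchars G"
  shows "qeval \<psi> (matrix_inv x ** u ** x) = qeval \<psi> u"
proof -
  have x': "matrix_inv x \<in> pts G" and ix: "invertible x" using x pts_inv[OF G] by (auto simp: pts_def)
  have "qeval \<psi> (matrix_inv x) * qeval \<psi> x = 1"
    using qchar_mult[OF G x' x \<psi>] by (simp add: matrix_inv_left[OF ix] qchar_one[OF G \<psi>])
  then show ?thesis
    using qchar_mult[OF G pts_mult[OF G x' u] x \<psi>] qchar_mult[OF G x' u \<psi>]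
    by (simp add: mult.commute mult.left_commute)
qed

text \<open>The value is a rational number independent of \<open>n\<close>, which ties the finite
  places to the real place.\<close>

lemma qchar_rat_unipotent:
  fixes n :: "'a::separated_algebra ^ 'n ^ 'n"
  assumes H: "q_group H" and N: "N \<subseteq> H" "\<forall>g\<in>N. unipotent g"
    and \<psi>: "\<psi> \<in> qchars H" and \<gamma>: "\<gamma> \<in> pts H" and n: "n \<in> pts N"
  shows "qeval \<psi> (map_matrix rat_incl \<gamma> ** n) = rat_incl (qeval \<psi> \<gamma>)"
proof -
  have "n \<in> pts H" using n pts_mono[OF N(1)] by blast
  then have "qeval \<psi> (map_matrix rat_incl \<gamma> ** n) = qeval \<psi> (map_matrix rat_incl \<gamma>) * qeval \<psi> n"
    by (intro qchar_mult[OF H pts_rat_incl[OF \<gamma>] _ \<psi>])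
  then show ?thesis
    using qchar_unipotent_pts[OF H N \<psi> n] \<gamma> by (simp add: qeval_rat_incl pts_def)
qed

lemma qchar_rat_nonzero:
  fixes \<gamma> :: "rat ^ 'n ^ 'n"
  assumes H: "q_group H" and \<psi>: "\<psi> \<in> qchars H" and \<gamma>: "\<gamma> \<in> pts H"
  shows "qeval \<psi> \<gamma> \<noteq> 0"
proof -
  have "invertible \<gamma>" using \<gamma> by (simp add: pts_def)
  then have "qeval \<psi> \<gamma> * qeval \<psi> (matrix_inv \<gamma>) = 1"
    using qchar_mult[OF H \<gamma> pts_inv[OF H \<gamma>] \<psi>] by (simp add: matrix_inv_right qchar_one[OF H \<psi>])
  then show ?thesis by auto
qed

text \<open>\<open>N\<close> is kept general for two uses: the unipotent radical of \<open>P\<close>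
  in the kernel of \<open>P\<close>, and the trivial group for elements of \<open>P\<close> in the
  kernel of \<open>G\<close>.\<close>

lemma regular_vanishing:
  fixes f :: "'n::finite adele_mat \<Rightarrow> complex"
  assumes G: "q_group G" and f: "parabolically_regular G f"
    and P: "parabolic G P" "P \<noteq> G" and N: "N \<subseteq> P" "\<forall>g\<in>N. unipotent g"
    and \<gamma>: "\<gamma> \<in> pts P" and n: "n \<in> adele_pts N" and x: "x \<in> adele_pts G"
  shows "f (inv\<^bsub>adele_gl\<^esub> x \<otimes>\<^bsub>adele_gl\<^esub> diag_incl \<gamma> \<otimes>\<^bsub>adele_gl\<^esub> n \<otimes>\<^bsub>adele_gl\<^esub> x) = 0"
proof -
  obtain K where K: "compact_open_subgroup G K"
    and supp: "\<forall>x\<in>adele_pts1 G. f x \<noteq> 0 \<longrightarrow> x \<in> K \<times> real_pts1 G"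
    and van: "\<forall>P. parabolic G P \<and> P \<noteq> G \<longrightarrow>
      (\<forall>g\<in>pts G. \<forall>x \<in> K \<times> real_pts1 P. f (fst x, g ** snd x ** matrix_inv g) = 0)"
    using f unfolding parabolically_regular_def by (elim exE conjE)
  have qP: "q_group P" and PG: "P \<subseteq> G" using P by (auto simp: parabolic_def)
  obtain x\<^sub>1 x\<^sub>2 where x_eq: "x = (x\<^sub>1, x\<^sub>2)" and x12: "x\<^sub>1 \<in> pts G" "x\<^sub>2 \<in> pts G"
    using x by (auto simp: adele_pts_def)
  obtain n\<^sub>1 n\<^sub>2 where n_eq: "n = (n\<^sub>1, n\<^sub>2)" and n12: "n\<^sub>1 \<in> pts N" "n\<^sub>2 \<in> pts N"
    using n by (auto simp: adele_pts_def)
  have ix: "invertible x\<^sub>1" "invertible x\<^sub>2" using x12 by (auto simp: pts_def)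
  define u\<^sub>1 where "u\<^sub>1 = map_matrix rat_incl \<gamma> ** n\<^sub>1"
  define u\<^sub>2 where "u\<^sub>2 = map_matrix rat_incl \<gamma> ** n\<^sub>2"
  have u12: "u\<^sub>1 \<in> pts P" "u\<^sub>2 \<in> pts P"
    unfolding u\<^sub>1_def u\<^sub>2_def using n12 pts_mono[OF N(1)] pts_rat_incl[OF \<gamma>]
    by (auto intro!: pts_mult[OF qP])
  then have uG: "u\<^sub>1 \<in> pts G" "u\<^sub>2 \<in> pts G" using pts_mono[OF PG] by auto
  have \<gamma>G: "\<gamma> \<in> pts G" using \<gamma> pts_mono[OF PG] by auto
  define y where "y = (matrix_inv x\<^sub>1 ** u\<^sub>1 ** x\<^sub>1, matrix_inv x\<^sub>2 ** u\<^sub>2 ** x\<^sub>2)"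
  have y: "inv\<^bsub>adele_gl\<^esub> x \<otimes>\<^bsub>adele_gl\<^esub> diag_incl \<gamma> \<otimes>\<^bsub>adele_gl\<^esub> n \<otimes>\<^bsub>adele_gl\<^esub> x = y"
    by (simp add: x_eq n_eq y_def u\<^sub>1_def u\<^sub>2_def diag_incl_def adele_inv[OF ix] adele_mult matrix_mul_assoc)
  \<comment> \<open>The support condition on \<open>f\<close> speaks of such points only.
    Conjugation does not affect characters of \<open>G\<close>, so the product formula for a
    rational number remains.\<close>
  have "y \<in> adele_pts1 G"
    unfolding adele_pts1_def
  proof (intro CollectI conjI ballI)
    show "y \<in> adele_pts G"
      unfolding y_def adele_pts_def by (intro SigmaI pts_mult[OF G] pts_inv[OF G] x12 uG)
    fix \<psi> assume \<psi>: "\<psi> \<in> qchars G"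
    have NG: "N \<subseteq> G" using N PG by blast
    show "char_abs \<psi> y = 1"
      unfolding char_abs_def y_def fst_conv snd_conv
        qchar_conj[OF G x12(1) uG(1) \<psi>] qchar_conj[OF G x12(2) uG(2) \<psi>]
      unfolding u\<^sub>1_def u\<^sub>2_def qchar_rat_unipotent[OF G NG N(2) \<psi> \<gamma>G n12(1)]
        qchar_rat_unipotent[OF G NG N(2) \<psi> \<gamma>G n12(2)]
      by (rule product_formula[OF qchar_rat_nonzero[OF G \<psi> \<gamma>G]])
  qed
  show ?thesis unfolding y
  proof (rule ccontr)
    assume "f y \<noteq> 0"
    then have yK: "matrix_inv x\<^sub>1 ** u\<^sub>1 ** x\<^sub>1 \<in> K"
      using supp \<open>y \<in> adele_pts1 G\<close> unfolding y_def by blast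
    have "\<bar>qeval \<psi> u\<^sub>2\<bar> = 1" if \<psi>: "\<psi> \<in> qchars P" for \<psi>
    proof -
      have "padic_abs p (qeval \<psi> \<gamma>) = 1" if p: "prime p" for p
        using qchar_compact[OF p qP u12(1) ix(1) _ _ yK \<psi>, of G] K
        by (simp add: compact_open_subgroup_def u\<^sub>1_def fadele_abs_rat[OF p]
            qchar_rat_unipotent[OF qP N \<psi> \<gamma> n12(1)])
      then have "\<bar>of_rat (qeval \<psi> \<gamma>) :: real\<bar> = 1" by (rule rat_abs_eq_1)
      then show ?thesis
        unfolding u\<^sub>2_def qchar_rat_unipotent[OF qP N \<psi> \<gamma> n12(2)] by (simp add: rat_incl_real_def)
    qed
    then have "(matrix_inv x\<^sub>1 ** u\<^sub>1 ** x\<^sub>1, u\<^sub>2) \<in> K \<times> real_pts1 P"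
      using yK u12 by (simp add: real_pts1_def)
    \<comment> \<open>The real component is conjugated by \<open>matrix_inv x\<^sub>2\<close>; the
      finite component lies in \<open>K\<close> in its conjugated form already.\<close>
    from van[rule_format, OF conjI[OF P] pts_inv[OF G x12(2)] this] have "f y = 0"
      by (simp add: y_def matrix_inv_inv[OF ix(2)])
    then show False using \<open>f y \<noteq> 0\<close> by simp
  qed
qed

section \<open>Stability of equivalence classes under conjugation\<close>

lemma matrix_diff_distrib:
  fixes A B C :: "'a::ring_1 ^ 'n ^ 'n"
  shows "A ** (B - C) = A ** B - A ** C" "(B - C) ** A = B ** A - C ** A"
  by (simp_all add: matrix_matrix_mult_def vec_eq_iff left_diff_distrib right_diff_distrib sum_subtractf)

lemma map_matrix_rat_incl_mult:
  fixes A B :: "rat ^ 'n ^ 'n"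
  shows "map_matrix rat_incl (A ** B)
    = (map_matrix rat_incl A ** map_matrix rat_incl B :: 'a::rat_algebra ^ 'n ^ 'n)"
proof -
  have "rat_incl (sum g S) = (\<Sum>i\<in>S. rat_incl (g i) :: 'a)" for g and S :: "'n set"
    by (induction S rule: infinite_finite_induct) (simp_all add: rat_incl_add)
  then show ?thesis
    by (simp add: map_matrix_def matrix_matrix_mult_def vec_eq_iff rat_incl_mult)
qed

lemma matrix_conj_mult:
  assumes "invertible x"
  shows "matrix_inv x ** (a ** b) ** x = (matrix_inv x ** a ** x) ** (matrix_inv x ** b ** x)"
proof -
  have "(matrix_inv x ** a ** x) ** (matrix_inv x ** b ** x)
      = matrix_inv x ** a ** (x ** matrix_inv x) ** b ** x"
    by (simp add: matrix_mul_assoc)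
  then show ?thesis using assms by (simp add: matrix_inv_right matrix_mul_assoc)
qed

lemma unipotent_conj:
  fixes x :: "'a::comm_ring_1 ^ 'n ^ 'n"
  assumes x: "invertible x" and u: "unipotent u" shows "unipotent (matrix_inv x ** u ** x)"
proof -
  obtain k where k: "matpow (u - mat 1) k = 0" using u by (auto simp: unipotent_def matpow_def)
  have "matrix_inv x ** u ** x - mat 1 = matrix_inv x ** (u - mat 1) ** x"
    using x by (simp add: matrix_diff_distrib matrix_inv_left)
  then have "matpow (matrix_inv x ** u ** x - mat 1) k = 0"
    by (simp add: matpow_conj[OF x] k)
  then show ?thesis by (auto simp: unipotent_def matpow_def)
qed

text \<open>If \<open>c\<close> diagonalizes \<open>s\<close>, then \<open>c\<close> times the
  complex form of \<open>x\<close> diagonalizes the conjugate.\<close>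

lemma semisimple_conj:
  fixes x s :: "rat ^ 'n ^ 'n"
  assumes x: "invertible x" and s: "semisimple s" shows "semisimple (matrix_inv x ** s ** x)"
proof -
  let ?m = "map_matrix of_rat :: rat ^ 'n ^ 'n \<Rightarrow> complex ^ 'n ^ 'n"
  obtain c :: "complex ^ 'n ^ 'n" where c: "invertible c"
    and diag: "\<And>i j. i \<noteq> j \<Longrightarrow> (c ** ?m s ** matrix_inv c) $ i $ j = 0"
    using s unfolding semisimple_def by blast
  have mx: "invertible (?m x)" "matrix_inv (?m x) = ?m (matrix_inv x)"
    using gl_rel_rat_incl[OF x, where 'a = complex] by (auto simp: gl_rel_def rat_incl_complex_def)
  have "c ** ?m x ** ?m (matrix_inv x ** s ** x) ** matrix_inv (c ** ?m x)
      = c ** (?m x ** matrix_inv (?m x)) ** ?m s ** (?m x ** matrix_inv (?m x)) ** matrix_inv c"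
    by (simp add: map_matrix_rat_incl_mult[where 'a = complex, unfolded rat_incl_complex_def]
        invertible_times c mx matrix_mul_assoc)
  also have "\<dots> = c ** ?m s ** matrix_inv c" by (simp only: matrix_inv_right[OF mx(1)] matrix_mul_rid)
  finally show ?thesis
    unfolding semisimple_def using diag invertible_times(1)[OF c mx(1)]
    by (intro exI[of _ "c ** ?m x"]) simp
qed

text \<open>A Jordan decomposition of \<gamma> is conjugated along with it; its semisimple part is
  then the conjugate of \<open>s\<close> by \<open>matrix_inv \<delta> ** d\<close>. Membership is
  tested against the representative \<open>g\<close> of the class.\<close>

lemma ss_class_conj:
  fixes \<gamma> \<delta> :: "rat ^ 'n ^ 'n"
  assumes G: "q_group G" and \<oo>: "\<oo> \<in> pts G // ss_equiv G" and \<gamma>: "\<gamma> \<in> \<oo>" and \<delta>: "\<delta> \<in> pts G"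
  shows "matrix_inv \<delta> ** \<gamma> ** \<delta> \<in> \<oo>"
proof -
  have i\<delta>: "invertible \<delta>" using \<delta> by (simp add: pts_def)
  obtain g where o_eq: "\<oo> = ss_equiv G `` {g}" using \<oo> by (rule quotientE)
  then obtain s u s' u' d where *: "g \<in> pts G" "\<gamma> \<in> pts G" "jordan_decomposition g s u"
      "semisimple s'" "unipotent u'" "\<gamma> = s' ** u'" "s' ** u' = u' ** s'"
      "d \<in> pts G" "s' = d ** s ** matrix_inv d"
    using \<gamma> by (auto simp: ss_equiv_def jordan_decomposition_def)
  have id: "invertible d" using *(8) by (simp add: pts_def)
  let ?c = "\<lambda>a. matrix_inv \<delta> ** a ** \<delta>"
  have "jordan_decomposition (?c \<gamma>) (?c s') (?c u')"
    unfolding jordan_decomposition_def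
    using *(4-7) by (auto simp: semisimple_conj[OF i\<delta>] unipotent_conj[OF i\<delta>] simp flip: matrix_conj_mult[OF i\<delta>])
  moreover have "?c s' = (matrix_inv \<delta> ** d) ** s ** matrix_inv (matrix_inv \<delta> ** d)"
    using *(9) by (simp add: invertible_times invertible_matrix_inv matrix_inv_inv i\<delta> id matrix_mul_assoc)
  moreover have "matrix_inv \<delta> ** d \<in> pts G" "?c \<gamma> \<in> pts G"
    by (intro pts_mult[OF G] pts_inv[OF G] \<delta> *)+
  ultimately have "(g, ?c \<gamma>) \<in> ss_equiv G"
    using *(1,3) unfolding ss_equiv_def by blast
  then show ?thesis by (simp add: o_eq)
qed

section \<open>Radicals, cosets and their representatives\<close>

lemma unipotent_radical_subset: "unipotent_radical H \<subseteq> H"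
proof -
  have "N \<subseteq> H" if "N \<lhd> gl\<lparr>carrier := H\<rparr>" for N
    using that by (auto dest!: normal_imp_subgroup subgroup.subset)
  then show ?thesis unfolding unipotent_radical_def by blast
qed

lemma unipotent_radical_unipotent: "g \<in> unipotent_radical H \<Longrightarrow> unipotent g"
  unfolding unipotent_radical_def by blast

lemma levi_trivial_radical:
  assumes "unipotent_radical G = {mat 1}" "levi_component G L" shows "L = G"
  using assms unfolding levi_component_def set_mult_def by (simp add: gl_def)

text \<open>\<open>quotient_top\<close> is built with \<open>topology\<close>, so its open sets are
  accessible only after \<open>istopology\<close> is proved. The inclusion shows that points of the
  measure space are cosets of adelic points.\<close>

lemma topspace_quotient_top: "topspace (quotient_top G) \<subseteq> adelic_quotient G"
proof -
  define L where "L = (\<lambda>U. U \<subseteq> adelic_quotient G \<and> openin (adele_top1 G)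
     {x \<in> adele_pts1 G. (diag_incl ` pts G) #>\<^bsub>adele_gl\<^esub> x \<in> U})"
  have "istopology L"
    unfolding istopology_def
  proof (intro conjI allI impI)
    fix S T assume "L S" "L T"
    then have S: "S \<subseteq> adelic_quotient G" "openin (adele_top1 G)
        {x \<in> adele_pts1 G. (diag_incl ` pts G) #>\<^bsub>adele_gl\<^esub> x \<in> S}"
      and T: "openin (adele_top1 G) {x \<in> adele_pts1 G. (diag_incl ` pts G) #>\<^bsub>adele_gl\<^esub> x \<in> T}"
      by (auto simp: L_def)
    have "{x \<in> adele_pts1 G. (diag_incl ` pts G) #>\<^bsub>adele_gl\<^esub> x \<in> S \<inter> T}
        = {x \<in> adele_pts1 G. (diag_incl ` pts G) #>\<^bsub>adele_gl\<^esub> x \<in> S}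
          \<inter> {x \<in> adele_pts1 G. (diag_incl ` pts G) #>\<^bsub>adele_gl\<^esub> x \<in> T}" by blast
    then show "L (S \<inter> T)" using S(1) openin_Int[OF S(2) T] unfolding L_def by auto
  next
    fix \<K> assume K: "\<forall>S\<in>\<K>. L S"
    have "{x \<in> adele_pts1 G. (diag_incl ` pts G) #>\<^bsub>adele_gl\<^esub> x \<in> \<Union>\<K>}
        = \<Union>((\<lambda>S. {x \<in> adele_pts1 G. (diag_incl ` pts G) #>\<^bsub>adele_gl\<^esub> x \<in> S}) ` \<K>)" by blast
    moreover have "openin (adele_top1 G) \<dots>"
      by (rule openin_Union) (use K in \<open>auto simp: L_def\<close>)
    moreover have "\<Union>\<K> \<subseteq> adelic_quotient G" using K unfolding L_def by blast
    ultimately show "L (\<Union>\<K>)" unfolding L_def by simp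
  qed
  then have "openin (quotient_top G) = L"
    unfolding quotient_top_def L_def by (rule topology_inverse')
  then have "L (topspace (quotient_top G))" by (metis openin_topspace)
  then show ?thesis by (simp add: L_def)
qed

lemma rep_in: "C \<noteq> {} \<Longrightarrow> rep C \<in> C"
  unfolding rep_def by (metis ex_in_conv someI_ex)

lemma diag_mult_adele_pts:
  assumes G: "q_group G" and "\<gamma> \<in> pts G" "x \<in> adele_pts G"
  shows "diag_incl \<gamma> \<otimes>\<^bsub>adele_gl\<^esub> x \<in> adele_pts G"
  using assms by (auto simp: adele_pts_def diag_incl_def adele_mult intro!: pts_mult[OF G] pts_rat_incl)

lemma rep_adelic_quotient:
  assumes G: "q_group G" and C: "C \<in> adelic_quotient G"
  shows "rep C \<in> adele_pts G"
proof -
  obtain a where a: "a \<in> adele_pts1 G" and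
    C_eq: "C = (\<lambda>h. h \<otimes>\<^bsub>adele_gl\<^esub> a) ` diag_incl ` pts G"
    using C by (auto simp: adelic_quotient_def RCOSETS_def r_coset_def)
  have "C \<noteq> {}" using pts_one[OF G] C_eq by blast
  then have "rep C \<in> C" by (rule rep_in)
  then obtain \<gamma> where "\<gamma> \<in> pts G" "rep C = diag_incl \<gamma> \<otimes>\<^bsub>adele_gl\<^esub> a"
    unfolding C_eq by blast
  then show ?thesis using a diag_mult_adele_pts[OF G] by (simp add: adele_pts1_def)
qed

lemma rep_rational_coset:
  assumes G: "q_group G" and P: "q_group P" "P \<subseteq> G"
    and C: "C \<in> rcosets\<^bsub>gl\<lparr>carrier := pts G\<rparr>\<^esub> (pts P :: (rat ^ 'n ^ 'n) set)"
  shows "rep C \<in> pts G"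
proof -
  obtain a where a: "a \<in> pts G" and C_eq: "C = (\<lambda>h. h ** a) ` pts P"
    using C by (auto simp: RCOSETS_def r_coset_def gl_def)
  have "C \<noteq> {}" using pts_one[OF P(1)] C_eq by blast
  then have "rep C \<in> C" by (rule rep_in)
  then show ?thesis using a C_eq pts_mono[OF P(2)] by (auto intro!: pts_mult[OF G])
qed

text \<open>Reduces the inner sum of the truncated kernel at \<open>P = G\<close> to one
  term.\<close>

lemma rcosets_self:
  assumes G: "q_group G"
  shows "rcosets\<^bsub>gl\<lparr>carrier := pts G\<rparr>\<^esub> (pts G) = {pts G :: (rat ^ 'n ^ 'n) set}"
proof -
  have "(\<lambda>h. h ** a) ` pts G = pts G" if a: "a \<in> pts G" for a :: "rat ^ 'n ^ 'n"
  proof (intro equalityI subsetI)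
    fix h assume h: "h \<in> (pts G :: (rat ^ 'n ^ 'n) set)"
    have "invertible a" using a by (simp add: pts_def)
    then have "h = (h ** matrix_inv a) ** a" by (simp add: matrix_inv_left flip: matrix_mul_assoc)
    then show "h \<in> (\<lambda>h. h ** a) ` pts G"
      using pts_mult[OF G h pts_inv[OF G a]] by blast
  qed (use a in \<open>auto intro: pts_mult[OF G]\<close>)
  moreover have "rcosets\<^bsub>gl\<lparr>carrier := pts G\<rparr>\<^esub> (pts G)
      = (\<lambda>a. (\<lambda>h. h ** a) ` pts G) ` (pts G :: (rat ^ 'n ^ 'n) set)"
    by (auto simp: RCOSETS_def r_coset_def gl_def)
  ultimately show ?thesis using pts_one[OF G, where 'a = rat] by auto
qed

text \<open>A larger group has a smaller vanishing ideal and hence a larger Lie algebra.\<close>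

lemma roots_mono: "H \<subseteq> H' \<Longrightarrow> roots A H \<subseteq> roots A H'"
  using vanishing_ideal_mono[of H H'] unfolding roots_def lie_algebra_def by blast

section \<open>Arthur's kernels and distributions\<close>

context arthur_setting
begin

lemma space_haar:
  assumes "parabolic G P" "P\<^sub>0 \<subseteq> P"
  shows "space (\<nu> P) = adele_pts (unipotent_radical P)"
  using haar[OF assms]
  by (auto simp: unipotent_haar_def borel_radon_def adele_top_def pts_top_def
      topspace_pullback_topology adele_pts_def)

text \<open>Each integrand vanishes identically on the space of \<open>\<nu> P\<close>, so no
  question of convergence enters.\<close>

lemma kernel_proper_parabolic:
  assumes G: "q_group G" and f: "parabolically_regular G f"
    and P: "parabolic G P" "P\<^sub>0 \<subseteq> P" "P \<noteq> G" and x: "x \<in> adele_pts G"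
  shows "kernel f \<oo> P x x = 0"
  unfolding kernel_def
proof (rule infsum_0)
  fix \<gamma> assume "\<gamma> \<in> pts (lev P) \<inter> \<oo>"
  moreover have "lev P \<subseteq> P" using lev[OF P(1,2)] by (simp add: levi_component_def)
  ultimately have \<gamma>: "\<gamma> \<in> pts P" using pts_mono by blast
  have "(\<integral>n. f (inv\<^bsub>adele_gl\<^esub> x \<otimes>\<^bsub>adele_gl\<^esub> diag_incl \<gamma> \<otimes>\<^bsub>adele_gl\<^esub> n \<otimes>\<^bsub>adele_gl\<^esub> x) \<partial>\<nu> P)
      = (\<integral>n. 0 \<partial>\<nu> P)"
    by (rule Bochner_Integration.integral_cong[OF refl],
        rule regular_vanishing[OF G f P(1,3) unipotent_radical_subset _ \<gamma> _ x])
       (auto simp: unipotent_radical_unipotent space_haar[OF P(1,2)])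
  then show "(\<integral>n. f (inv\<^bsub>adele_gl\<^esub> x \<otimes>\<^bsub>adele_gl\<^esub> diag_incl \<gamma> \<otimes>\<^bsub>adele_gl\<^esub> n \<otimes>\<^bsub>adele_gl\<^esub> x) \<partial>\<nu> P) = 0"
    by simp
qed

context
  assumes reductive: "connected_reductive G"
begin

lemma q_group_G: "q_group G"
  using reductive by (simp add: connected_reductive_def)

lemma radical_G: "unipotent_radical G = {mat 1}"
  using reductive by (simp add: connected_reductive_def)

lemma parabolic_G: "parabolic G G" "P\<^sub>0 \<subseteq> G"
  using minimal_parabolic q_group_G by (auto simp: minimal_parabolic_def parabolic_def)

lemma lev_G: "lev G = G"
  using lev[OF parabolic_G] levi_trivial_radical[OF radical_G] by blast

lemma haar_G_trivial: "n \<in> space (\<nu> G) \<Longrightarrow> n = (mat 1, mat 1)"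
  using pts_trivial[where 'a = fadele] pts_trivial[where 'a = real]
  unfolding space_haar[OF parabolic_G] radical_G adele_pts_def by blast

text \<open>In a non-elliptic class every rational point of \<open>G\<close> lies in some proper
  parabolic subgroup, which may vary with the point.\<close>

lemma kernel_G_nonelliptic:
  assumes f: "parabolically_regular G f" and \<oo>: "\<not> elliptic_class G \<oo>" and x: "x \<in> adele_pts G"
  shows "kernel f \<oo> G x x = 0"
  unfolding kernel_def lev_G
proof (rule infsum_0)
  fix \<gamma> assume "\<gamma> \<in> pts G \<inter> \<oo>"
  then obtain P where P: "parabolic G P" "P \<noteq> G" and \<gamma>: "\<gamma> \<in> pts P"
    using \<oo> by (auto simp: elliptic_class_def elliptic_def)
  have "pts P = P" "q_group P" using P by (auto simp: parabolic_def q_group_def)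
  then have one: "{mat 1} \<subseteq> P" using q_group_closed(1)[of P] by simp
  have uni: "\<forall>g\<in>{mat 1 :: complex ^ 'n ^ 'n}. unipotent g"
    using radical_G unipotent_radical_unipotent by blast
  have "(\<integral>n. f (inv\<^bsub>adele_gl\<^esub> x \<otimes>\<^bsub>adele_gl\<^esub> diag_incl \<gamma> \<otimes>\<^bsub>adele_gl\<^esub> n \<otimes>\<^bsub>adele_gl\<^esub> x) \<partial>\<nu> G)
      = (\<integral>n. 0 \<partial>\<nu> G)"
    by (rule Bochner_Integration.integral_cong[OF refl],
        rule regular_vanishing[OF q_group_G f P one uni \<gamma> _ x])
       (auto simp: space_haar[OF parabolic_G] radical_G)
  then show "(\<integral>n. f (inv\<^bsub>adele_gl\<^esub> x \<otimes>\<^bsub>adele_gl\<^esub> diag_incl \<gamma> \<otimes>\<^bsub>adele_gl\<^esub> n \<otimes>\<^bsub>adele_gl\<^esub> x) \<partial>\<nu> G) = 0"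
    by simp
qed

text \<open>Replacing \<open>x\<close> by its translate replaces \<gamma> by a conjugate, and
  conjugation permutes the class. This removes the arbitrary representative of the single coset at
  \<open>P = G\<close>.\<close>

lemma kernel_G_invariant:
  assumes \<oo>: "\<oo> \<in> pts G // ss_equiv G" and \<delta>: "\<delta> \<in> pts G" and x: "x \<in> adele_pts G"
  shows "kernel f \<oo> G (diag_incl \<delta> \<otimes>\<^bsub>adele_gl\<^esub> x) (diag_incl \<delta> \<otimes>\<^bsub>adele_gl\<^esub> x) = kernel f \<oo> G x x"
proof -
  note G = q_group_G
  have i\<delta>: "invertible \<delta>" using \<delta> by (simp add: pts_def)
  have \<delta>': "matrix_inv \<delta> \<in> pts G" by (rule pts_inv[OF G \<delta>])
  let ?c = "\<lambda>\<gamma>. matrix_inv \<delta> ** \<gamma> ** \<delta>"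
  obtain x\<^sub>1 x\<^sub>2 where x_eq: "x = (x\<^sub>1, x\<^sub>2)" and ix: "invertible x\<^sub>1" "invertible x\<^sub>2"
    using x by (auto simp: adele_pts_def pts_def)
  define I where "I y \<gamma> = (\<integral>n. f (inv\<^bsub>adele_gl\<^esub> y \<otimes>\<^bsub>adele_gl\<^esub> diag_incl \<gamma> \<otimes>\<^bsub>adele_gl\<^esub> n \<otimes>\<^bsub>adele_gl\<^esub> y) \<partial>\<nu> G)" for y \<gamma>
  let ?y = "diag_incl \<delta> \<otimes>\<^bsub>adele_gl\<^esub> x"
  have I: "I ?y \<gamma> = I x (?c \<gamma>)" for \<gamma>
    unfolding I_def
  proof (rule Bochner_Integration.integral_cong[OF refl], drule haar_G_trivial)
    fix n :: "'n adele_mat" assume "n = (mat 1, mat 1)"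
    then show "f (inv\<^bsub>adele_gl\<^esub> ?y \<otimes>\<^bsub>adele_gl\<^esub> diag_incl \<gamma> \<otimes>\<^bsub>adele_gl\<^esub> n \<otimes>\<^bsub>adele_gl\<^esub> ?y)
        = f (inv\<^bsub>adele_gl\<^esub> x \<otimes>\<^bsub>adele_gl\<^esub> diag_incl (?c \<gamma>) \<otimes>\<^bsub>adele_gl\<^esub> n \<otimes>\<^bsub>adele_gl\<^esub> x)"
      using gl_rel_rat_incl[OF i\<delta>, where 'a = real] gl_rel_rat_incl[OF i\<delta>, where 'a = fadele]
      by (simp add: x_eq diag_incl_def adele_mult adele_inv ix gl_rel_def invertible_times map_matrix_rat_incl_mult matrix_mul_assoc)
  qed
  have "bij_betw ?c (pts G \<inter> \<oo>) (pts G \<inter> \<oo>)"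
  proof (rule bij_betw_byWitness[where f' = "\<lambda>\<gamma>. matrix_inv (matrix_inv \<delta>) ** \<gamma> ** matrix_inv \<delta>"])
    have "\<delta> ** (matrix_inv \<delta> ** \<gamma> ** \<delta>) ** matrix_inv \<delta> = (\<delta> ** matrix_inv \<delta>) ** \<gamma> ** (\<delta> ** matrix_inv \<delta>)"
      "matrix_inv \<delta> ** (\<delta> ** \<gamma> ** matrix_inv \<delta>) ** \<delta> = (matrix_inv \<delta> ** \<delta>) ** \<gamma> ** (matrix_inv \<delta> ** \<delta>)"
      for \<gamma> by (simp_all add: matrix_mul_assoc)
    then show "\<forall>\<gamma>\<in>pts G \<inter> \<oo>. matrix_inv (matrix_inv \<delta>) ** ?c \<gamma> ** matrix_inv \<delta> = \<gamma>"
      "\<forall>\<gamma>\<in>pts G \<inter> \<oo>. ?c (matrix_inv (matrix_inv \<delta>) ** \<gamma> ** matrix_inv \<delta>) = \<gamma>"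
      by (simp_all add: matrix_inv_inv[OF i\<delta>] matrix_inv_left[OF i\<delta>] matrix_inv_right[OF i\<delta>])
    show "?c ` (pts G \<inter> \<oo>) \<subseteq> pts G \<inter> \<oo>"
      using ss_class_conj[OF G \<oo> _ \<delta>] by (auto intro!: pts_mult[OF G] \<delta> \<delta>')
    show "(\<lambda>\<gamma>. matrix_inv (matrix_inv \<delta>) ** \<gamma> ** matrix_inv \<delta>) ` (pts G \<inter> \<oo>) \<subseteq> pts G \<inter> \<oo>"
      using ss_class_conj[OF G \<oo> _ \<delta>'] by (auto intro!: pts_mult[OF G] pts_inv[OF G] \<delta> \<delta>')
  qed
  from infsum_reindex_bij_betw[OF this, of "I x"]
  have "(\<Sum>\<^sub>\<infinity>\<gamma>\<in>pts G \<inter> \<oo>. I ?y \<gamma>) = (\<Sum>\<^sub>\<infinity>\<gamma>\<in>pts G \<inter> \<oo>. I x \<gamma>)" by (simp add: I)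
  then show ?thesis by (simp add: kernel_def lev_G I_def)
qed

text \<open>Every simple root is a root of \<open>lev G = G\<close>, so \<open>weights G\<close> is
  empty and the condition in \<open>tau_hat\<close> is vacuous.\<close>

lemma tau_hat_G: "tau_hat G X = 1"
proof -
  have "\<Delta>\<^sub>0 \<subseteq> roots A\<^sub>0 (unipotent_radical P\<^sub>0)" by (auto simp: \<Delta>\<^sub>0_def simple_roots_def)
  also have "\<dots> \<subseteq> roots A\<^sub>0 G"
    using unipotent_radical_subset[of P\<^sub>0] parabolic_G(2) by (intro roots_mono) blast
  finally show ?thesis by (auto simp: tau_hat_def weights_def lev_G)
qed

lemma truncated_kernel_eq:
  assumes f: "parabolically_regular G f" and \<oo>: "\<oo> \<in> pts G // ss_equiv G" and x: "x \<in> adele_pts G"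
  shows "truncated_kernel f \<oo> x = kernel f \<oo> G x x"
proof -
  define t where "t P = (-1) ^ (torus_dim (split_center (lev P)) - torus_dim (split_center G)) *
     (\<Sum>\<^sub>\<infinity>C \<in> rcosets\<^bsub>gl\<lparr>carrier := pts G\<rparr>\<^esub> (pts P).
        let y = diag_incl (rep C) \<otimes>\<^bsub>adele_gl\<^esub> x
        in kernel f \<oo> P y y * of_real (tau_hat P (\<lambda>\<psi>. height y \<psi> - T \<psi>)))" for P
  have "t P = 0" if P: "parabolic G P" "P\<^sub>0 \<subseteq> P" "P \<noteq> G" for P
  proof -
    have "q_group P" "P \<subseteq> G" using P by (auto simp: parabolic_def)
    then have "diag_incl (rep C) \<otimes>\<^bsub>adele_gl\<^esub> x \<in> adele_pts G"
      if "C \<in> rcosets\<^bsub>gl\<lparr>carrier := pts G\<rparr>\<^esub> (pts P)" for C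
      by (intro diag_mult_adele_pts[OF q_group_G _ x] rep_rational_coset[OF q_group_G _ _ that])
    then show ?thesis unfolding t_def
      by (simp add: kernel_proper_parabolic[OF q_group_G f P] Let_def infsum_0)
  qed
  then have "(\<Sum>\<^sub>\<infinity>P | parabolic G P \<and> P\<^sub>0 \<subseteq> P. t P) = (\<Sum>\<^sub>\<infinity>P\<in>{G}. t P)"
    by (intro infsum_cong_neutral) (use parabolic_G in auto)
  also have "\<dots> = t G" by simp
  also have "\<dots> = kernel f \<oo> G x x"
  proof -
    \<comment> \<open>The chosen representative is an unspecified rational point, not necessarily
      the identity; invariance of the kernel absorbs it. The sign has exponent 0, as
      \<open>lev G = G\<close>.\<close>
    have "rep (pts G) \<in> (pts G :: (rat ^ 'n ^ 'n) set)"
      by (rule rep_in) (use pts_one[OF q_group_G, where 'a = rat] in auto)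
    then show ?thesis unfolding t_def
      by (simp add: rcosets_self[OF q_group_G] lev_G tau_hat_G Let_def kernel_G_invariant[OF \<oo> _ x])
  qed
  finally show ?thesis by (simp add: truncated_kernel_def t_def)
qed

lemma rep_quotient_measure: "C \<in> space \<mu> \<Longrightarrow> rep C \<in> adele_pts G"
  using quotient_measure topspace_quotient_top[of G] rep_adelic_quotient[OF q_group_G]
  by (auto simp: quotient_measure_def borel_radon_def)

text \<open>The integrands agree at every point of the measure space, so the integrals agree
  whatever their convergence.\<close>

lemma J_eq:
  assumes "parabolically_regular G f" "\<oo> \<in> pts G // ss_equiv G"
  shows "J f \<oo> = (\<integral>C. kernel f \<oo> G (rep C) (rep C) \<partial>\<mu>)"
  unfolding J_def
  by (rule Bochner_Integration.integral_cong[OF refl])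
     (simp add: truncated_kernel_eq[OF assms] rep_quotient_measure)

lemma J_nonelliptic:
  assumes "parabolically_regular G f" "\<oo> \<in> pts G // ss_equiv G" "\<not> elliptic_class G \<oo>"
  shows "J f \<oo> = 0"
proof -
  have "J f \<oo> = (\<integral>C. 0 \<partial>\<mu>)"
    unfolding J_eq[OF assms(1,2)]
    by (rule Bochner_Integration.integral_cong[OF refl])
       (simp add: kernel_G_nonelliptic[OF assms(1,3)] rep_quotient_measure)
  then show ?thesis by simp
qed

end

end

theorem proposition1p1:
  fixes G P\<^sub>0 L\<^sub>0 :: "(complex ^ 'n ^ 'n) set"
    and K :: "'n adele_mat set"
    and lev :: "(complex ^ 'n ^ 'n) set \<Rightarrow> (complex ^ 'n ^ 'n) set"
    and T :: "'n coweight"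
    and \<nu> :: "(complex ^ 'n ^ 'n) set \<Rightarrow> 'n adele_mat measure"
    and \<mu> :: "'n adele_mat set measure"
    and f :: "'n adele_mat \<Rightarrow> complex"
    and \<oo> :: "(rat ^ 'n ^ 'n) set"
  assumes "connected_reductive G"
    and "arthur_setting G P\<^sub>0 L\<^sub>0 K lev T \<nu> \<mu>"
    and "test_function G f"
    and "parabolically_regular G f"
    and "\<oo> \<in> pts G // ss_equiv G"
  shows "(\<not> elliptic_class G \<oo> \<longrightarrow> arthur_setting.J G P\<^sub>0 L\<^sub>0 K lev T \<nu> \<mu> f \<oo> = 0) \<and>
    (elliptic_class G \<oo> \<longrightarrow> arthur_setting.J G P\<^sub>0 L\<^sub>0 K lev T \<nu> \<mu> f \<oo> =
       (\<integral>C. arthur_setting.kernel lev \<nu> f \<oo> G (rep C) (rep C) \<partial>\<mu>))"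
  using arthur_setting.J_eq[OF assms(2,1,4,5)] arthur_setting.J_nonelliptic[OF assms(2,1,4,5)]
  by blast

end
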